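(* Let $\widehat{A}=A+\epsilon B\in\mathbb{DR}^{n\times n}$ with $\operatorname{Ind}(A)=m$, and write $\widehat{A}^{m}=A^{m}+\epsilon S$, where $S=\sum_{i=1}^{m}A^{m-i}BA^{i-1}$. Then the following statements are equivalent: (i) the dual core-EP generalized inverse of $\widehat{A}$ exists; (ii) $\widehat{A}=U\begin{bmatrix} T_1 & T_2 \\ O & N \end{bmatrix}U^{T}+\epsilon\,U\begin{bmatrix} B_1 & B_2 \\ B_3 & B_4 \end{bmatrix}U^{T}$ (conformably partitioned real blocks), where $U$ is a real unitary (orthogonal) matrix, $T_1$ is nonsingular, $N^{m}=O$, and $$\sum_{i=1}^{m}N^{m-i}B_3T_1^{i-m-1}\widetilde{T}=\sum_{i=1}^{m}\left(N^{m-i}B_3F_i+N^{m-i}B_4N^{i-1}\right),$$ where $\widetilde{T}=\sum_{i=0}^{m-1}T_1^{i}T_2N^{m-1-i}$ and $F_i=\sum_{j=0}^{i-2}T_1^{j}T_2N^{i-2-j}$ (so $F_1=O$); (iii) $\left(I-A^{m}(A^{m})^{\dagger_{c}}\right)S\left(I-(A^{m})^{\dagger_{c}}A^{m}\right)=O$, where $(A^m)^{\dagger_c}$ denotes the core-EP inverse of the real matrix $A^m$.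
   Context: Dual numbers are $a+\epsilon b$ with $a,b\in\mathbb{R}$, $\epsilon\neq 0$, $\epsilon^2=0$. $\mathbb{DR}^{n\times n}$ is the set of dual real matrices $\widehat{A}=A+\epsilon B$, $A,B\in\mathbb{R}^{n\times n}$, with product $(A+\epsilon B)(C+\epsilon D)=AC+\epsilon(AD+BC)$ and transpose $(A+\epsilon B)^T=A^T+\epsilon B^T$. $\operatorname{Ind}(A)$ is the smallest nonnegative integer $s$ with $\operatorname{rank}(A^{s+1})=\operatorname{rank}(A^s)$. For a real square matrix $C$ with $\operatorname{Ind}(C)=k$, its core-EP inverse $C^{\dagger_c}$ is the unique real matrix $X$ with $(CX)^T=CX$, $CX^2=X$, $XC^{k+1}=C^k$ (it always exists). For $\widehat{A}=A+\epsilon B$ with $\operatorname{Ind}(A)=m$, a dual core-EP generalized inverse of $\widehat{A}$ is $\widehat{X}\in\mathbb{DR}^{n\times n}$ with $(\widehat{A}\widehat{X})^{T}=\widehat{A}\widehat{X}$, $\widehat{A}\widehat{X}^{2}=\widehat{X}$, $\widehat{X}\widehat{A}^{m+1}=\widehat{A}^{m}$. *)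

theory Defs
  imports
    Complex_Main
    "Jordan_Normal_Form.Matrix"
    "Jordan_Normal_Form.Gauss_Jordan_Elimination"
    "Jordan_Normal_Form.DL_Rank"
begin

section \<open>Dual real numbers\<close>

datatype dual_real = Dual (std_part: real) (eps_part: real)

instantiation dual_real :: "{comm_ring_1, real_algebra_1}"
begin

definition "0 = Dual 0 0"
definition "1 = Dual 1 0"
definition "x + y = Dual (std_part x + std_part y) (eps_part x + eps_part y)"
definition "- x = Dual (- std_part x) (- eps_part x)"
definition "x - y = Dual (std_part x - std_part y) (eps_part x - eps_part y)"
definition "x * y =
  Dual (std_part x * std_part y) (std_part x * eps_part y + eps_part x * std_part y)"
definition "r *\<^sub>R x = Dual (r * std_part x) (r * eps_part x)"

instance
  by standard
    (auto simp: zero_dual_real_def one_dual_real_def plus_dual_real_def uminus_dual_real_def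
      minus_dual_real_def times_dual_real_def scaleR_dual_real_def algebra_simps)

end

definition dual_eps :: dual_real where
  "dual_eps = Dual 0 1"

lemma dual_eps_nonzero: "dual_eps \<noteq> 0"
  by (simp add: dual_eps_def zero_dual_real_def)

lemma dual_eps_square: "dual_eps\<^sup>2 = 0"
  by (simp add: dual_eps_def zero_dual_real_def times_dual_real_def power2_eq_square)

lemma Dual_eq: "Dual a b = of_real a + dual_eps * of_real b"
  by (simp add: dual_eps_def of_real_def plus_dual_real_def times_dual_real_def
      scaleR_dual_real_def one_dual_real_def)

lemma Dual_simps:
  "Dual a b + Dual c d = Dual (a + c) (b + d)"
  "Dual a b * Dual c d = Dual (a * c) (a * d + b * c)"
  by (simp_all add: plus_dual_real_def times_dual_real_def)

lemma Dual_sum: "(\<Sum>i\<in>I. Dual (f i) (g i)) = Dual (\<Sum>i\<in>I. f i) (\<Sum>i\<in>I. g i)"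
  by (induction I rule: infinite_finite_induct) (simp_all add: Dual_simps zero_dual_real_def)


section \<open>Matrix notions\<close>

text \<open>The type of matrices is not a monoid, hence sums carry explicit dimensions; an empty sum
  is the zero matrix of that shape.\<close>

definition mat_sum :: "nat \<Rightarrow> nat \<Rightarrow> ('i \<Rightarrow> 'a::comm_monoid_add mat) \<Rightarrow> 'i set \<Rightarrow> 'a mat" where
  "mat_sum nr nc f I = mat nr nc (\<lambda>(p, q). \<Sum>i\<in>I. f i $$ (p, q))"

text \<open>Integer powers; for negative exponents only meaningful for nonsingular \<open>T\<close>, since
  \<open>mat_inverse\<close> returns \<open>None\<close> otherwise.\<close>

definition mat_powi :: "'a::field mat \<Rightarrow> int \<Rightarrow> 'a mat" where
  "mat_powi T k = (if k \<ge> 0 then T ^\<^sub>m nat k else the (mat_inverse T) ^\<^sub>m nat (- k))"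

definition real_unitary :: "real mat \<Rightarrow> bool" where
  "real_unitary U \<longleftrightarrow> square_mat U \<and> inverts_mat U (transpose_mat U) \<and> inverts_mat (transpose_mat U) U"

definition mat_rank :: "real mat \<Rightarrow> nat" where
  "mat_rank A = vec_space.rank (dim_row A) A"

definition mat_index :: "real mat \<Rightarrow> nat" where
  "mat_index A = (LEAST s. mat_rank (A ^\<^sub>m (s + 1)) = mat_rank (A ^\<^sub>m s))"

definition is_core_ep_inverse :: "real mat \<Rightarrow> real mat \<Rightarrow> bool" where
  "is_core_ep_inverse C X \<longleftrightarrow>
     X \<in> carrier_mat (dim_row C) (dim_row C) \<and>
     transpose_mat (C * X) = C * X \<and>
     C * X ^\<^sub>m 2 = X \<and>
     X * C ^\<^sub>m (mat_index C + 1) = C ^\<^sub>m mat_index C"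

definition core_ep_inverse :: "real mat \<Rightarrow> real mat" where
  "core_ep_inverse C = (THE X. is_core_ep_inverse C X)"


section \<open>Dual real matrices\<close>

definition dual_mat :: "real mat \<Rightarrow> real mat \<Rightarrow> dual_real mat" where
  "dual_mat A B = map_mat of_real A + dual_eps \<cdot>\<^sub>m map_mat of_real B"

definition is_dual_core_ep_inverse :: "dual_real mat \<Rightarrow> dual_real mat \<Rightarrow> bool" where
  "is_dual_core_ep_inverse M X \<longleftrightarrow>
     (let m = mat_index (map_mat std_part M) in
       X \<in> carrier_mat (dim_row M) (dim_row M) \<and>
       transpose_mat (M * X) = M * X \<and>
       M * X ^\<^sub>m 2 = X \<and>
       X * M ^\<^sub>m (m + 1) = M ^\<^sub>m m)"

lemma dual_mat_carrier [simp]: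
  "B \<in> carrier_mat nr nc \<Longrightarrow> dual_mat A B \<in> carrier_mat nr nc"
  by (auto simp: dual_mat_def)

lemma dual_mat_index:
  assumes "A \<in> carrier_mat nr nc" "B \<in> carrier_mat nr nc" "i < nr" "j < nc"
  shows "dual_mat A B $$ (i, j) = Dual (A $$ (i, j)) (B $$ (i, j))"
  using assms by (simp add: dual_mat_def Dual_eq)

lemma map_std_part_dual_mat:
  assumes "A \<in> carrier_mat nr nc" "B \<in> carrier_mat nr nc"
  shows "map_mat std_part (dual_mat A B) = A"
  using assms dual_mat_carrier[OF assms(2), of A]
  by (intro eq_matI) (auto simp: dual_mat_index simp del: dual_mat_carrier)

lemma dual_mat_surj:
  assumes "M \<in> carrier_mat nr nc"
  shows "dual_mat (map_mat std_part M) (map_mat eps_part M) = M"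
  using assms by (intro eq_matI) (auto simp: dual_mat_def simp flip: Dual_eq)

lemma transpose_dual_mat:
  assumes "A \<in> carrier_mat nr nc" "B \<in> carrier_mat nr nc"
  shows "transpose_mat (dual_mat A B) = dual_mat (transpose_mat A) (transpose_mat B)"
  using assms by (intro eq_matI) (auto simp: dual_mat_def)

lemma dual_mat_mult:
  assumes A: "A \<in> carrier_mat nr n" and B: "B \<in> carrier_mat nr n"
    and C: "C \<in> carrier_mat n nc" and D: "D \<in> carrier_mat n nc"
  shows "dual_mat A B * dual_mat C D = dual_mat (A * C) (A * D + B * C)"
proof (rule eq_matI)
  have c: "A * C \<in> carrier_mat nr nc" "A * D + B * C \<in> carrier_mat nr nc"
    using assms by auto
  have dAB: "dual_mat A B \<in> carrier_mat nr n" and dCD: "dual_mat C D \<in> carrier_mat n nc"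
    using B D by simp_all
  show "dim_row (dual_mat A B * dual_mat C D) = dim_row (dual_mat (A * C) (A * D + B * C))"
    "dim_col (dual_mat A B * dual_mat C D) = dim_col (dual_mat (A * C) (A * D + B * C))"
    using dAB dCD dual_mat_carrier[OF c(2), of "A * C"] by auto
  fix i j
  assume "i < dim_row (dual_mat (A * C) (A * D + B * C))"
    "j < dim_col (dual_mat (A * C) (A * D + B * C))"
  then have ij: "i < nr" "j < nc"
    using dual_mat_carrier[OF c(2), of "A * C"] by auto
  have "(dual_mat A B * dual_mat C D) $$ (i, j) =
      (\<Sum>k\<in>{0..<n}. dual_mat A B $$ (i, k) * dual_mat C D $$ (k, j))"
    using dAB dCD ij by (simp add: scalar_prod_def carrier_matD)
  also have "\<dots> = (\<Sum>k\<in>{0..<n}. Dual (A $$ (i, k) * C $$ (k, j))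
      (A $$ (i, k) * D $$ (k, j) + B $$ (i, k) * C $$ (k, j)))"
    using ij by (intro sum.cong refl) (simp add: dual_mat_index[OF A B] dual_mat_index[OF C D] Dual_simps)
  also have "\<dots> = dual_mat (A * C) (A * D + B * C) $$ (i, j)"
    using assms ij
    by (simp add: dual_mat_index[OF c] Dual_sum sum.distrib scalar_prod_def carrier_matD)
  finally show "(dual_mat A B * dual_mat C D) $$ (i, j) =
      dual_mat (A * C) (A * D + B * C) $$ (i, j)" .
qed

lemma mat_sum_carrier [simp]: "mat_sum nr nc f I \<in> carrier_mat nr nc"
  by (simp add: mat_sum_def)

lemma dual_mat_pow:
  assumes A: "A \<in> carrier_mat n n" and B: "B \<in> carrier_mat n n"
  shows "dual_mat A B ^\<^sub>m m =
    dual_mat (A ^\<^sub>m m) (mat_sum n n (\<lambda>i. A ^\<^sub>m (m - i) * B * A ^\<^sub>m (i - 1)) {1..m})"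
proof (induction m)
  case 0
  show ?case
    using A B by (intro eq_matI) (auto simp: dual_mat_def mat_sum_def)
next
  case (Suc m)
  have "A ^\<^sub>m m * B + mat_sum n n (\<lambda>i. A ^\<^sub>m (m - i) * B * A ^\<^sub>m (i - 1)) {1..m} * A =
      mat_sum n n (\<lambda>i. A ^\<^sub>m (Suc m - i) * B * A ^\<^sub>m (i - 1)) {1..Suc m}"
    (is "?P + ?S m * A = ?R")
  proof -
    have pc: "A ^\<^sub>m k \<in> carrier_mat n n" for k
      using A by (rule pow_carrier_mat)
    have comm: "A * A ^\<^sub>m k = A ^\<^sub>m Suc k" for k
    proof (induction k)
      case 0
      show ?case using A by simp
    next
      case (Suc k)
      have "A * A ^\<^sub>m Suc k = A * A ^\<^sub>m k * A"
        using A pc[of k] by (simp add: assoc_mult_mat[of A n n _ n _ n])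
      then show ?case using Suc by simp
    qed
    have dist: "mat_sum n n f I * A = mat_sum n n (\<lambda>i. f i * A) I"
      if "\<And>i. i \<in> I \<Longrightarrow> f i \<in> carrier_mat n n" for f and I :: "nat set"
    proof (rule eq_matI)
      fix p q
      assume "p < dim_row (mat_sum n n (\<lambda>i. f i * A) I)" "q < dim_col (mat_sum n n (\<lambda>i. f i * A) I)"
      then have pq: "p < n" "q < n" by (auto simp: mat_sum_def)
      have "(mat_sum n n f I * A) $$ (p, q) = (\<Sum>k\<in>{0..<n}. (\<Sum>i\<in>I. f i $$ (p, k)) * A $$ (k, q))"
        using A pq by (simp add: scalar_prod_def mat_sum_def carrier_matD)
      also have "\<dots> = (\<Sum>i\<in>I. \<Sum>k\<in>{0..<n}. f i $$ (p, k) * A $$ (k, q))"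
        by (simp add: sum_distrib_right sum.swap[of _ I])
      also have "\<dots> = (\<Sum>i\<in>I. (f i * A) $$ (p, q))"
        using A pq carrier_matD[OF that] by (intro sum.cong refl) (simp add: scalar_prod_def)
      finally show "(mat_sum n n f I * A) $$ (p, q) = mat_sum n n (\<lambda>i. f i * A) I $$ (p, q)"
        using pq by (simp add: mat_sum_def)
    qed (use A in \<open>auto simp: mat_sum_def\<close>)
    have tc: "A ^\<^sub>m i * B * A ^\<^sub>m j \<in> carrier_mat n n" for i j
      using pc[of i] pc[of j] B by simp
    have shift: "A ^\<^sub>m (m - i) * B * A ^\<^sub>m (i - 1) * A = A ^\<^sub>m (m - i) * B * A ^\<^sub>m i"
      if "i \<ge> 1" for i
    proof -
      have "A ^\<^sub>m (m - i) * B \<in> carrier_mat n n" using pc[of "m - i"] B by simp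
      then have "A ^\<^sub>m (m - i) * B * A ^\<^sub>m (i - 1) * A = A ^\<^sub>m (m - i) * B * (A ^\<^sub>m (i - 1) * A)"
        using pc[of "i - 1"] A by (simp add: assoc_mult_mat[of _ n n _ n _ n])
      then show ?thesis using that by (cases i) auto
    qed
    have "?P = A ^\<^sub>m (m - 0) * B * A ^\<^sub>m 0"
      using pc[of m] A B right_mult_one_mat[of "A ^\<^sub>m m * B" n n] by simp
    then have P: "?P $$ (p, q) = (A ^\<^sub>m (m - 0) * B * A ^\<^sub>m 0) $$ (p, q)" for p q
      by (rule arg_cong)
    show ?thesis
    proof (rule eq_matI)
      fix p q
      assume "p < dim_row ?R" "q < dim_col ?R"
      then have pq: "p < n" "q < n" by (auto simp: mat_sum_def)
      have SA: "?S m * A = mat_sum n n (\<lambda>i. A ^\<^sub>m (m - i) * B * A ^\<^sub>m (i - 1) * A) {1..m}"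
        by (rule dist) (rule tc)
      have "(?P + ?S m * A) $$ (p, q) = ?P $$ (p, q) + (?S m * A) $$ (p, q)"
        using pq A by (intro index_add_mat) (auto simp: mat_sum_def)
      also have "(?S m * A) $$ (p, q) = (\<Sum>i=1..m. (A ^\<^sub>m (m - i) * B * A ^\<^sub>m i) $$ (p, q))"
        unfolding SA using pq shift by (auto simp: mat_sum_def intro!: sum.cong)
      also have "?P $$ (p, q) + \<dots> = (\<Sum>i=0..m. (A ^\<^sub>m (m - i) * B * A ^\<^sub>m i) $$ (p, q))"
        by (subst P) (simp only: sum.atLeast_Suc_atMost[of 0 m] One_nat_def)
      also have "\<dots> = ?R $$ (p, q)"
        using pq
        by (simp add: mat_sum_def sum.shift_bounds_cl_Suc_ivl del: sum.cl_ivl_Suc)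
      finally show "(?P + ?S m * A) $$ (p, q) = ?R $$ (p, q)" .
    qed (use A in \<open>auto simp: mat_sum_def\<close>)
  qed
  then show ?case
    using Suc A B by (simp add: dual_mat_mult[of _ n n _ _ n])
qed

end

theory Submission
  imports Defs
begin

text \<open>Write \<open>C = A ^ m\<close>, let \<open>X\<close> be its core-EP inverse, and let \<open>C' = C + \<epsilon> S\<close> be the \<open>m\<close>-th power of the dual
  matrix \<open>A' = A + \<epsilon> B\<close>. Both equivalences pass through the corner condition
  \<open>(1 - C * X) * S * (1 - X * C) = 0\<close>, which says that the first order perturbation \<open>S\<close> maps the kernel of
  \<open>C\<close> into its range, that is, that \<open>C'\<close> still has an inner inverse.

  If \<open>Y\<close> is a dual core-EP inverse of \<open>A'\<close>, then \<open>A' * Y ^ (m + 1)\<close> is an inner inverse \<open>G\<close> of \<open>C'\<close>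
  (lemma \<open>core_ep_inner_inverse_of_power\<close>). The infinitesimal part of \<open>C' * G * C' = C'\<close> exhibits \<open>S\<close> as a sum of
  terms with \<open>C\<close> on one side, and all of these vanish in the corner
  (lemma \<open>dual_inner_inverse_imp_corner_zero\<close>).

  Conversely, under the corner condition an explicit infinitesimal correction turns \<open>X\<close> into a core inverse
  \<open>W\<close> of \<open>C'\<close> (lemma \<open>corner_zero_imp_dual_core_inverse\<close>), and then \<open>A' ^ (m - 1) * W\<close> is a dual core-EP
  inverse of \<open>A'\<close> when \<open>m > 0\<close> (lemma \<open>core_ep_inverse_from_power\<close>); for \<open>m = 0\<close> the matrix \<open>A'\<close> is invertible.

  The block equation is the corner condition in the coordinates of an orthogonal decomposition of \<open>A\<close> into a
  nonsingular and a nilpotent part (lemma \<open>corner_zero_iff_block_equation\<close>). Such a decomposition exists for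
  every real matrix (lemma \<open>core_ep_decomposition_index\<close>), by splitting off left null vectors with Householder
  reflections; it also shows that \<open>X\<close> exists.\<close>

section \<open>Rank and the index\<close>

text \<open>A basis of the subspace is independent in the whole space and large enough to span it.\<close>
lemma (in vectorspace) eq_carrier_of_dim_le:
  assumes fd: "fin_dim" and W: "subspace K W V" and fdW: "vectorspace.fin_dim K (vs W)"
    and d: "dim \<le> vectorspace.dim K (vs W)"
  shows "W = carrier V"
proof -
  interpret W: vectorspace K "vs W" by (rule subspace_is_vs[OF W])
  have sub: "submodule K W V" using W by (simp add: subspace_def)
  have WV: "W \<subseteq> carrier V" using sub by (simp add: submodule_def)
  obtain b where b: "finite b" "W.basis b" using W.finite_basis_exists fdW by blast
  have bW: "b \<subseteq> W" and sp: "W.span b = W" and li: "W.lin_indpt b"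
    using b(2) by (auto simp: W.basis_def)
  have "lin_indpt b" using li span_li_not_depend(2)[OF bW sub] by simp
  moreover have "dim \<le> card b" using d W.dim_basis[OF b] by simp
  ultimately have "basis b" using dim_li_is_basis[OF fd b(1)] bW WV by blast
  then have "span b = carrier V" by (simp add: basis_def)
  then show ?thesis using sp span_li_not_depend(1)[OF bW sub] by simp
qed

context vec_space begin

lemma col_space_subspace:
  assumes "A \<in> carrier_mat n k"
  shows "subspace class_ring (col_space A) V"
  unfolding col_space_def using assms cols_dim[of A] by (intro span_is_subspace) auto

lemma col_space_mult_subset:
  assumes A: "A \<in> carrier_mat n k" and B: "B \<in> carrier_mat k l"
  shows "col_space (A * B) \<subseteq> col_space A"
proof
  fix y assume "y \<in> col_space (A * B)"
  then obtain x where x: "x \<in> carrier_vec l" "y = A * B *\<^sub>v x" "y \<in> carrier_vec n"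
    using A B by (auto simp: col_space_eq[OF mult_carrier_mat[OF A B]])
  then have "y = A *\<^sub>v (B *\<^sub>v x)" using A B by simp
  then show "y \<in> col_space A" using A B x by (auto simp: col_space_eq[OF A])
qed

lemma rank_mult_le:
  assumes A: "A \<in> carrier_mat n k" and B: "B \<in> carrier_mat k l"
  shows "rank (A * B) \<le> rank A"
proof -
  have AB: "A * B \<in> carrier_mat n l" using A B by simp
  interpret W: vectorspace class_ring "vs (col_space A)"
    by (rule subspace_is_vs[OF col_space_subspace[OF A]])
  have "subspace class_ring (col_space (A * B)) (vs (col_space A))"
    by (rule nested_subspaces[OF col_space_subspace[OF A] col_space_subspace[OF AB]
          col_space_mult_subset[OF A B]])
  then show ?thesis
    unfolding rank_def col_space_def[symmetric]
    using W.subspace_dim[of "col_space (A * B)"] fin_dim_span_cols[OF A] fin_dim_span_cols[OF AB]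
    by (simp add: col_space_def)
qed

text \<open>The column space of \<open>A * B\<close> lies in that of \<open>A\<close>; equal ranks make the two equal, and the columns of
  \<open>Z\<close> are coordinates of the columns of \<open>A\<close> with respect to those of \<open>A * B\<close>.\<close>
lemma rank_mult_eq_imp_factor:
  assumes A: "A \<in> carrier_mat n k" and B: "B \<in> carrier_mat k l" and eq: "rank (A * B) = rank A"
  obtains Z where "Z \<in> carrier_mat l k" "A = A * B * Z"
proof -
  have AB: "A * B \<in> carrier_mat n l" using A B by simp
  interpret W: vectorspace class_ring "vs (col_space A)"
    by (rule subspace_is_vs[OF col_space_subspace[OF A]])
  have "subspace class_ring (col_space (A * B)) (vs (col_space A))"
    by (rule nested_subspaces[OF col_space_subspace[OF A] col_space_subspace[OF AB]
          col_space_mult_subset[OF A B]])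
  then have "col_space (A * B) = carrier (vs (col_space A))"
    using W.eq_carrier_of_dim_le[of "col_space (A * B)"]
      fin_dim_span_cols[OF A] fin_dim_span_cols[OF AB] eq
    by (simp add: col_space_def rank_def)
  then have cs: "col_space (A * B) = col_space A" by simp
  have "\<exists>x. x \<in> carrier_vec l \<and> A * B *\<^sub>v x = col A j" if "j < k" for j
  proof -
    have "col A j \<in> col_space A"
      using A that cols_dim[of A] unfolding col_space_def
      by (intro span_mem) (auto simp: cols_def)
    then show ?thesis using A B unfolding cs[symmetric] col_space_eq[OF AB] by auto
  qed
  then obtain x where x: "\<And>j. j < k \<Longrightarrow> x j \<in> carrier_vec l \<and> A * B *\<^sub>v x j = col A j" by metis
  define Z where "Z = mat_of_cols l (map x [0..<k])"
  have Z: "Z \<in> carrier_mat l k" by (simp add: Z_def mat_of_cols_def)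
  have "A * B * Z = A"
  proof (rule mat_col_eqI)
    fix j assume "j < dim_col A"
    then have j: "j < k" using A by simp
    have "col Z j = x j" using j x[OF j] by (auto simp: Z_def)
    then show "col (A * B * Z) j = col A j" unfolding col_mult2[OF AB Z j] \<open>col Z j = x j\<close> using x[OF j] by blast
  qed (use A B Z in auto)
  with Z that show thesis by metis
qed

end

text \<open>This is the only way in which the rank enters: at the index, \<open>A ^ m\<close> and \<open>A ^ (m + 1)\<close> have the
  same column space, so \<open>A ^ m\<close> is a right multiple of \<open>A ^ (m + 1)\<close>. The defining minimum is attained
  because a sequence of naturals cannot decrease for ever.\<close>
lemma mat_index_pow_factor:
  fixes A :: "real mat"
  assumes A: "A \<in> carrier_mat n n"
  obtains Z where "Z \<in> carrier_mat n n" "A ^\<^sub>m mat_index A = A ^\<^sub>m (mat_index A + 1) * Z"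
proof -
  let ?r = "\<lambda>s. mat_rank (A ^\<^sub>m s)"
  have r: "?r s = vec_space.rank n (A ^\<^sub>m s)" for s using A by (simp add: mat_rank_def)
  have le: "?r (s + 1) \<le> ?r s" for s
    unfolding r using vec_space.rank_mult_le[OF pow_carrier_mat[OF A, of s] A] by simp
  have "\<exists>s. ?r (s + 1) = ?r s"
  proof (rule ccontr)
    assume "\<not> ?thesis"
    then have lt: "?r (Suc s) < ?r s" for s using le[of s] by (auto simp: less_le)
    have "?r s + s \<le> ?r 0" for s
    proof (induction s)
      case (Suc s)
      then show ?case using lt[of s] by linarith
    qed simp
    from this[of "Suc (?r 0)"] show False by simp
  qed
  then have "?r (mat_index A + 1) = ?r (mat_index A)"
    unfolding mat_index_def by (rule LeastI_ex)
  then have "vec_space.rank n (A ^\<^sub>m mat_index A * A) = vec_space.rank n (A ^\<^sub>m mat_index A)"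
    using A by (simp add: mat_rank_def)
  then show thesis
    using vec_space.rank_mult_eq_imp_factor[OF pow_carrier_mat[OF A] A] that by (metis Suc_eq_plus1 pow_mat.simps(2))
qed

section \<open>Core-EP inverses over commutative rings\<close>

lemma pow_mat_add:
  fixes A :: "'a :: semiring_1 mat"
  assumes A: "A \<in> carrier_mat n n"
  shows "A ^\<^sub>m (i + j) = A ^\<^sub>m i * A ^\<^sub>m j"
proof (induction j)
  case 0
  show ?case using A pow_carrier_mat[OF A, of i] by simp
next
  case (Suc j)
  then show ?case
    using A assoc_mult_mat[OF pow_carrier_mat[OF A, of i] pow_carrier_mat[OF A, of j] A] by simp
qed

lemma pow_mat_commute:
  fixes A :: "'a :: semiring_1 mat"
  assumes A: "A \<in> carrier_mat n n"
  shows "A ^\<^sub>m i * A ^\<^sub>m j = A ^\<^sub>m j * A ^\<^sub>m i"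
  by (simp only: pow_mat_add[OF A, symmetric] add.commute)

lemma pow_mat_Suc_left:
  fixes A :: "'a :: semiring_1 mat"
  assumes A: "A \<in> carrier_mat n n"
  shows "A ^\<^sub>m Suc k = A * A ^\<^sub>m k"
  using pow_mat_commute[OF A, of k 1] A by simp

lemma pow_mat_2:
  fixes A :: "'a :: semiring_1 mat"
  assumes A: "A \<in> carrier_mat n n"
  shows "A ^\<^sub>m 2 = A * A"
  using A by (simp add: numeral_2_eq_2)

text \<open>The identities below hold over any commutative ring; they are needed both for real matrices and
  for dual matrices. Iterating \<open>X = A * X\<^sup>2\<close> moves arbitrarily high powers of \<open>A\<close> to the left of \<open>X\<close>, which
  is what lets the equation \<open>X * A ^ (k + 1) = A ^ k\<close> act.\<close>
lemma outer_inverse_eq_powers: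
  fixes A X :: "'a :: semiring_1 mat"
  assumes A: "A \<in> carrier_mat n n" and X: "X \<in> carrier_mat n n" and AXX: "A * X ^\<^sub>m 2 = X"
  shows "A ^\<^sub>m k * X ^\<^sub>m Suc k = X"
proof (induction k)
  case 0
  show ?case using A X by simp
next
  case (Suc k)
  have "X ^\<^sub>m Suc k = A * X ^\<^sub>m 2 * X ^\<^sub>m k"
    unfolding AXX by (rule pow_mat_Suc_left[OF X])
  also have "\<dots> = A * X ^\<^sub>m (2 + k)"
    unfolding pow_mat_add[OF X] using A X by (intro assoc_mult_mat[of _ n n _ n _ n]) auto
  finally have "X = A ^\<^sub>m k * (A * X ^\<^sub>m Suc (Suc k))" using Suc by simp
  also have "\<dots> = A ^\<^sub>m Suc k * X ^\<^sub>m Suc (Suc k)"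
    unfolding pow_mat.simps(2)[of A k]
    using A X by (intro assoc_mult_mat[of _ n n _ n _ n, symmetric]) auto
  finally show ?case by simp
qed

lemma core_ep_idempotent_fixes_power:
  fixes A X :: "'a :: semiring_1 mat"
  assumes A: "A \<in> carrier_mat n n" and X: "X \<in> carrier_mat n n" and AXX: "A * X ^\<^sub>m 2 = X"
    and XA: "X * A ^\<^sub>m Suc k = A ^\<^sub>m k"
  shows "A * X * A ^\<^sub>m k = A ^\<^sub>m k"
proof -
  have "A * X * A ^\<^sub>m k = A * X * (X * A ^\<^sub>m Suc k)" using XA by simp
  also have "\<dots> = A * X ^\<^sub>m 2 * A ^\<^sub>m Suc k"
    using A X pow_carrier_mat[OF A, of "Suc k"]
    by (simp add: pow_mat_2[OF X] assoc_mult_mat[of _ n n _ n _ n] del: pow_mat.simps)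
  finally show ?thesis using AXX XA by simp
qed

lemma core_ep_idempotent_eq_powers:
  fixes A X :: "'a :: semiring_1 mat"
  assumes A: "A \<in> carrier_mat n n" and X: "X \<in> carrier_mat n n" and AXX: "A * X ^\<^sub>m 2 = X"
  shows "A * X = A ^\<^sub>m Suc k * X ^\<^sub>m Suc k"
proof -
  have "A * X = A * (A ^\<^sub>m k * X ^\<^sub>m Suc k)"
    using outer_inverse_eq_powers[OF A X AXX, of k] by simp
  also have "\<dots> = A * A ^\<^sub>m k * X ^\<^sub>m Suc k"
    using A X by (intro assoc_mult_mat[of _ n n _ n _ n, symmetric]) auto
  finally show ?thesis unfolding pow_mat_Suc_left[OF A, symmetric] .
qed

text \<open>The middle factor is an inner inverse of \<open>A ^ k\<close>. Over the dual numbers the existence of an inner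
  inverse is a genuine restriction, and it is this one that the corner condition expresses.\<close>
lemma core_ep_inner_inverse_of_power:
  fixes A X :: "'a :: semiring_1 mat"
  assumes A: "A \<in> carrier_mat n n" and X: "X \<in> carrier_mat n n" and AXX: "A * X ^\<^sub>m 2 = X"
    and XA: "X * A ^\<^sub>m Suc k = A ^\<^sub>m k"
  shows "A ^\<^sub>m k * (A * X ^\<^sub>m Suc k) * A ^\<^sub>m k = A ^\<^sub>m k"
proof -
  have "A ^\<^sub>m k * (A * X ^\<^sub>m Suc k) = A * X"
    unfolding core_ep_idempotent_eq_powers[OF A X AXX, of k] pow_mat.simps(2)[of A k]
    using A X by (intro assoc_mult_mat[of _ n n _ n _ n, symmetric]) auto
  then show ?thesis using core_ep_idempotent_fixes_power[OF assms] by simp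
qed

lemma core_ep_projector_mult:
  fixes A X Y :: "'a :: semiring_1 mat"
  assumes A: "A \<in> carrier_mat n n"
    and X: "X \<in> carrier_mat n n" and AXX: "A * X ^\<^sub>m 2 = X" and XA: "X * A ^\<^sub>m Suc k = A ^\<^sub>m k"
    and Y: "Y \<in> carrier_mat n n" and AYY: "A * Y ^\<^sub>m 2 = Y"
  shows "A * X * (A * Y) = A * Y"
proof -
  have pc: "A ^\<^sub>m j \<in> carrier_mat n n" "Y ^\<^sub>m j \<in> carrier_mat n n" for j using A Y by auto
  have AY: "A * Y = A ^\<^sub>m k * (A * Y ^\<^sub>m Suc k)"
    unfolding core_ep_idempotent_eq_powers[OF A Y AYY, of k] pow_mat.simps(2)[of A k]
    using A Y pc by (intro assoc_mult_mat[of _ n n _ n _ n]) auto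
  have "A * X * (A * Y) = A * X * A ^\<^sub>m k * (A * Y ^\<^sub>m Suc k)"
    unfolding AY using A X Y pc by (intro assoc_mult_mat[of _ n n _ n _ n, symmetric]) auto
  then show ?thesis
    unfolding core_ep_idempotent_fixes_power[OF A X AXX XA] AY[symmetric] .
qed

lemma core_ep_inverse_eq_times_projector:
  fixes A X Y :: "'a :: semiring_1 mat"
  assumes A: "A \<in> carrier_mat n n"
    and X: "X \<in> carrier_mat n n" and AXX: "A * X ^\<^sub>m 2 = X" and XA: "X * A ^\<^sub>m Suc k = A ^\<^sub>m k"
    and Y: "Y \<in> carrier_mat n n" and AYY: "A * Y ^\<^sub>m 2 = Y"
  shows "X * (A * Y) = Y"
proof -
  have pc: "A ^\<^sub>m j \<in> carrier_mat n n" "Y ^\<^sub>m j \<in> carrier_mat n n" for j using A Y by auto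
  have "X * (A * Y) = X * A ^\<^sub>m Suc k * Y ^\<^sub>m Suc k"
    unfolding core_ep_idempotent_eq_powers[OF A Y AYY, of k]
    by (rule assoc_mult_mat[OF X pc(1) pc(2), symmetric])
  then show ?thesis unfolding XA outer_inverse_eq_powers[OF A Y AYY] .
qed

text \<open>Two such inverses have \<open>A * X\<close> and \<open>A * Y\<close> with the same range, so multiplication by either one
  from the left fixes the other; transposing one of these equations, both being symmetric, makes them equal.\<close>
lemma core_ep_inverse_unique:
  fixes A X Y :: "'a :: comm_semiring_1 mat"
  assumes A: "A \<in> carrier_mat n n"
    and X: "X \<in> carrier_mat n n" "A * X ^\<^sub>m 2 = X" "X * A ^\<^sub>m Suc k = A ^\<^sub>m k"
    and symX: "transpose_mat (A * X) = A * X"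
    and Y: "Y \<in> carrier_mat n n" "A * Y ^\<^sub>m 2 = Y" "Y * A ^\<^sub>m Suc k = A ^\<^sub>m k"
    and symY: "transpose_mat (A * Y) = A * Y"
  shows "X = Y"
proof -
  have "A * X = transpose_mat (A * Y * (A * X))"
    unfolding core_ep_projector_mult[OF A Y X(1,2)] symX ..
  also have "\<dots> = A * X * (A * Y)"
    using A X(1) Y(1) transpose_mult[of "A * Y" n n "A * X" n] symX symY by simp
  also have "\<dots> = A * Y" by (rule core_ep_projector_mult[OF A X Y(1,2)])
  finally have "A * X = A * Y" .
  then have "X * (A * X) = X * (A * Y)" by simp
  then show ?thesis
    unfolding core_ep_inverse_eq_times_projector[OF A X X(1,2)]
      core_ep_inverse_eq_times_projector[OF A X Y(1,2)] .
qed

text \<open>The core-EP inverse for exponent one, without reference to the index. It makes sense over every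
  commutative ring and is the notion that is lifted from \<open>A ^ m\<close> to its dual counterpart.\<close>
definition core_inverse :: "'a :: semiring_1 mat \<Rightarrow> 'a mat \<Rightarrow> bool" where
  "core_inverse C X \<longleftrightarrow> X \<in> carrier_mat (dim_row C) (dim_row C) \<and>
     transpose_mat (C * X) = C * X \<and> C * (X * X) = X \<and> X * (C * C) = C"

lemma core_inverse_inner:
  assumes C: "C \<in> carrier_mat n n" and X: "core_inverse C X"
  shows "C * (X * C) = C" "X * (C * X) = X" "C * (X * X) = X" "X * (C * C) = C"
    "X \<in> carrier_mat n n" "transpose_mat (C * X) = C * X"
proof -
  show *: "C * (X * X) = X" "X * (C * C) = C" "X \<in> carrier_mat n n" "transpose_mat (C * X) = C * X"
    using C X by (auto simp: core_inverse_def)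
  note as = assoc_mult_mat[of _ n n _ n _ n]
  have "C * (X * C) = C * (X * (X * (C * C)))" using * by simp
  also have "\<dots> = C * (X * X) * (C * C)" using C *(3) by (simp add: as)
  finally show "C * (X * C) = C" using * by simp
  have "X * (C * X) = X * (C * (C * (X * X)))" using * by simp
  also have "\<dots> = X * (C * C) * (X * X)" using C *(3) by (simp add: as)
  finally show "X * (C * X) = X" using * by simp
qed

text \<open>The exponent in the definition of the core-EP inverse is the index of \<open>C\<close>. If it is positive, the
  equation for exponent one may be multiplied by further powers; if it is zero, then \<open>C\<close> is invertible
  and \<open>X * C\<^sup>2 = C\<close> can be cancelled.\<close>
lemma core_ep_inverse_eqI:
  fixes C :: "real mat"
  assumes C: "C \<in> carrier_mat n n" and X: "core_inverse C X"
  shows "core_ep_inverse C = X"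
proof -
  note ci = core_inverse_inner[OF C X]
  let ?k = "mat_index C"
  have k: "X * C ^\<^sub>m Suc ?k = C ^\<^sub>m ?k"
  proof (cases ?k)
    case 0
    obtain Z where Z: "Z \<in> carrier_mat n n" "C ^\<^sub>m ?k = C ^\<^sub>m (?k + 1) * Z"
      using mat_index_pow_factor[OF C] .
    then have CZ: "1\<^sub>m n = C * Z" using 0 C by simp
    have "X * C = X * C * (C * Z)" unfolding CZ[symmetric] using C ci(5) by simp
    also have "\<dots> = X * (C * C) * Z"
      using C ci(5) Z(1) by (simp add: assoc_mult_mat[of _ n n _ n _ n])
    also have "\<dots> = 1\<^sub>m n" unfolding ci(4) CZ ..
    finally show ?thesis using 0 C by simp
  next
    case (Suc j)
    have "C ^\<^sub>m Suc (Suc j) = C * C * C ^\<^sub>m j"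
      using C by (simp only: pow_mat_Suc_left[OF C]) (simp add: assoc_mult_mat[of _ n n _ n _ n])
    then have "X * C ^\<^sub>m Suc (Suc j) = X * (C * C) * C ^\<^sub>m j"
      using C ci(5) by (simp add: assoc_mult_mat[of _ n n _ n _ n])
    then show ?thesis unfolding Suc ci(4) by (simp only: pow_mat_Suc_left[OF C])
  qed
  have CXX: "C * X ^\<^sub>m 2 = X" using ci(3) pow_mat_2[OF ci(5)] by simp
  have "is_core_ep_inverse C X"
    using C ci k CXX by (simp add: is_core_ep_inverse_def)
  moreover have "Y = X" if "is_core_ep_inverse C Y" for Y
    using that C by (intro core_ep_inverse_unique[OF C _ _ _ _ ci(5) CXX k ci(6)])
      (auto simp: is_core_ep_inverse_def)
  ultimately show ?thesis unfolding core_ep_inverse_def by blast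
qed

text \<open>A core inverse \<open>W\<close> of a power \<open>C = M ^ (k + 1)\<close> gives an inverse of \<open>M\<close> with exponent \<open>k + 1\<close>. The point
  is that \<open>W * C\<close> commutes with \<open>M\<close>: it is the idempotent of the group inverse of \<open>C\<close>.\<close>
lemma core_ep_inverse_from_power:
  fixes M W :: "'a :: comm_semiring_1 mat"
  assumes M: "M \<in> carrier_mat n n" and W: "core_inverse (M ^\<^sub>m Suc k) W"
  defines "X \<equiv> M ^\<^sub>m k * W"
  shows "X \<in> carrier_mat n n" "transpose_mat (M * X) = M * X" "M * X ^\<^sub>m 2 = X"
    "X * M ^\<^sub>m Suc (Suc k) = M ^\<^sub>m Suc k"
proof -
  define C where "C = M ^\<^sub>m Suc k"
  define D where "D = M ^\<^sub>m k"
  have c: "C \<in> carrier_mat n n" "D \<in> carrier_mat n n" using M unfolding C_def D_def by auto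
  note w = core_inverse_inner[OF c(1) W[folded C_def]]
  note as = assoc_mult_mat[of _ n n _ n _ n]
  note carr = M c w(5)
  have DM: "D * M = C" by (simp add: C_def D_def)
  have MD: "M * D = C" unfolding C_def D_def by (rule pow_mat_Suc_left[OF M, symmetric])
  have DC: "D * C = C * D" unfolding C_def D_def by (rule pow_mat_commute[OF M])
  have MC: "M * C = C * M" unfolding C_def using pow_mat_commute[OF M, of 1 "Suc k"] M by simp
  have X: "X = D * W" by (simp add: X_def D_def)
  show Xc: "X \<in> carrier_mat n n" using carr by (simp add: X)
  have MX: "M * X = C * W" unfolding X MD[symmetric] using carr by (simp add: as)
  then show "transpose_mat (M * X) = M * X" using w by simp
  have DW: "D * W = C * (D * (W * W))"
  proof -
    have "D * W = D * (C * (W * W))" using w by simp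
    also have "\<dots> = D * C * (W * W)" using carr by (simp add: as)
    also have "\<dots> = C * (D * (W * W))" unfolding DC using carr by (simp add: as)
    finally show ?thesis .
  qed
  have "M * X ^\<^sub>m 2 = M * X * X" using Xc carr by (simp add: pow_mat_2[OF Xc] as)
  also have "\<dots> = C * W * (C * (D * (W * W)))" unfolding MX unfolding X DW ..
  also have "\<dots> = C * (W * C) * (D * (W * W))" using carr by (simp add: as)
  also have "\<dots> = X" unfolding w(1) DW[symmetric] X ..
  finally show "M * X ^\<^sub>m 2 = X" .
  \<comment> \<open>With \<open>Q = W * C\<close> both \<open>Q * M\<close> and \<open>M * Q\<close> are equal to \<open>Q * M * Q\<close>: the first by \<open>C * Q = C\<close>, the
    second because \<open>Q = C * (W * W * C)\<close> and \<open>Q * C = C\<close>.\<close>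
  have "W * C * M = W * (C * M)" using carr by (simp add: as)
  also have "\<dots> = W * (M * (C * (W * C)))" unfolding w(1) MC ..
  also have "\<dots> = W * (M * C * (W * C))" using carr by (simp add: as)
  also have "\<dots> = W * C * M * (W * C)" unfolding MC using carr by (simp add: as)
  also have "\<dots> = W * C * M * (C * (W * W) * C)" unfolding w(3) ..
  also have "\<dots> = W * C * (M * C) * (W * W * C)" using carr by (simp add: as)
  also have "\<dots> = W * (C * C) * (M * (W * W * C))" unfolding MC using carr by (simp add: as)
  also have "\<dots> = C * M * (W * W * C)" unfolding w(4) using carr by (simp add: as)
  also have "\<dots> = M * (C * (W * W)) * C" unfolding MC[symmetric] using carr by (simp add: as)
  also have "\<dots> = M * (W * C)" unfolding w(3) using carr by (simp add: as)
  finally have comm: "W * C * M = M * (W * C)" .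
  have "X * M ^\<^sub>m Suc (Suc k) = D * (W * C * M)"
    unfolding X pow_mat.simps(2)[of M "Suc k"] C_def[symmetric] using carr by (simp add: as)
  also have "\<dots> = D * M * (W * C)" unfolding comm using carr by (simp add: as)
  also have "\<dots> = M ^\<^sub>m Suc k" unfolding DM w(1) by (simp add: C_def)
  finally show "X * M ^\<^sub>m Suc (Suc k) = M ^\<^sub>m Suc k" .
qed

section \<open>Inner and core inverses of dual matrices\<close>

lemma dual_mat_eq_iff:
  assumes "A \<in> carrier_mat nr nc" "B \<in> carrier_mat nr nc"
    "C \<in> carrier_mat nr nc" "D \<in> carrier_mat nr nc"
  shows "dual_mat A B = dual_mat C D \<longleftrightarrow> A = C \<and> B = D"
proof
  have eps: "map_mat eps_part (dual_mat P Q) = Q"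
    if "P \<in> carrier_mat nr nc" "Q \<in> carrier_mat nr nc" for P Q
    using that dual_mat_carrier[OF that(2), of P]
    by (intro eq_matI) (auto simp: dual_mat_index simp del: dual_mat_carrier)
  assume eq: "dual_mat A B = dual_mat C D"
  show "A = C \<and> B = D"
    using arg_cong[OF eq, of "map_mat std_part"] arg_cong[OF eq, of "map_mat eps_part"] assms
    by (simp add: map_std_part_dual_mat eps)
qed simp

text \<open>The infinitesimal part of \<open>C' * G * C' = C'\<close> writes \<open>S\<close> as a sum of terms each of which begins or ends
  with \<open>C\<close>; the factors on the two sides of the corner annihilate all of them.\<close>
lemma dual_inner_inverse_imp_corner_zero:
  fixes C S X :: "real mat"
  assumes C: "C \<in> carrier_mat n n" and S: "S \<in> carrier_mat n n" and X: "X \<in> carrier_mat n n"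
    and CXC: "C * (X * C) = C"
    and G: "G \<in> carrier_mat n n" and inner: "dual_mat C S * G * dual_mat C S = dual_mat C S"
  shows "(1\<^sub>m n - C * X) * S * (1\<^sub>m n - X * C) = 0\<^sub>m n n"
proof -
  define G0 G1 where "G0 = map_mat std_part G" and "G1 = map_mat eps_part G"
  have g: "G0 \<in> carrier_mat n n" "G1 \<in> carrier_mat n n" using G by (auto simp: G0_def G1_def)
  have Geq: "G = dual_mat G0 G1" using dual_mat_surj[OF G] by (simp add: G0_def G1_def)
  note as = assoc_mult_mat[of _ n n _ n _ n]
  define L R where "L = 1\<^sub>m n - C * X" and "R = 1\<^sub>m n - X * C"
  have lr: "L \<in> carrier_mat n n" "R \<in> carrier_mat n n"
    using C X by (auto simp: L_def R_def intro!: minus_carrier_mat)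
  have LC: "L * C = 0\<^sub>m n n"
    using C X CXC unfolding L_def
    by (subst minus_mult_distrib_mat[of _ n n _ _ n]) (auto simp: as)
  have CR: "C * R = 0\<^sub>m n n"
    using C X CXC unfolding R_def
    by (subst mult_minus_distrib_mat[of _ n n _ n]) (auto simp: as)
  have "C * G0 * S + (C * G1 + S * G0) * C = S"
  proof -
    have "dual_mat C S * G * dual_mat C S
        = dual_mat (C * G0 * C) (C * G0 * S + (C * G1 + S * G0) * C)"
      using C S g unfolding Geq by (simp add: dual_mat_mult[of _ n n _ _ n] del: assoc_mult_mat)
    moreover have "C * G0 * C \<in> carrier_mat n n"
      "C * G0 * S + (C * G1 + S * G0) * C \<in> carrier_mat n n"
      using C S g by auto
    ultimately show ?thesis using inner dual_mat_eq_iff[OF _ _ C S] by metis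
  qed
  then have "L * S * R = L * (C * G0 * S + (C * G1 + S * G0) * C) * R" by simp
  also have "\<dots> = L * C * (G0 * S * R) + (L * C * (G1 * (C * R)) + L * S * G0 * (C * R))"
    using C S g lr
    by (simp add: as add_mult_distrib_mat[of _ n n _ _ n] mult_add_distrib_mat[of _ n n _ n])
  also have "\<dots> = 0\<^sub>m n n"
    unfolding LC CR using C S g lr by simp
  finally show ?thesis unfolding L_def R_def .
qed

text \<open>The core inverse is perturbed to first order. Let \<open>D = (1 - C * X) * S\<close> be the component of the
  perturbation that leaves the range of \<open>C\<close>. The corner condition says \<open>D = D * X * C\<close>, which makes
  \<open>R = D * X + (D * X)\<^sup>T\<close> a symmetric first order correction of the projector \<open>C * X\<close> onto that range.
  Solving \<open>C * Y + S * X = R\<close> together with \<open>W = C' * W\<^sup>2\<close> for the infinitesimal part \<open>Y\<close> of \<open>W\<close> gives the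
  formula for \<open>Y\<close> in the proof.\<close>
lemma corner_zero_imp_dual_core_inverse:
  fixes C S X :: "real mat"
  assumes C: "C \<in> carrier_mat n n" and S: "S \<in> carrier_mat n n" and X: "core_inverse C X"
    and corner: "(1\<^sub>m n - C * X) * S * (1\<^sub>m n - X * C) = 0\<^sub>m n n"
  obtains W where "core_inverse (dual_mat C S) W"
proof -
  note x = core_inverse_inner[OF C X]
  note as = assoc_mult_mat[of _ n n _ n _ n]
  note ma = minus_mult_distrib_mat[of _ n n _ _ n] mult_minus_distrib_mat[of _ n n _ n]
    add_mult_distrib_mat[of _ n n _ _ n] mult_add_distrib_mat[of _ n n _ n]
  define D where "D = S - C * X * S"
  define Et where "Et = transpose_mat (D * X)"
  have d: "D \<in> carrier_mat n n" using C S x(5) by (auto simp: D_def intro!: minus_carrier_mat)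
  have et: "Et \<in> carrier_mat n n" using d x(5) by (auto simp: Et_def)
  note carr = C S x(5) d et
  have mc: "P - Q \<in> carrier_mat n n" if "P \<in> carrier_mat n n" "Q \<in> carrier_mat n n" for P Q :: "real mat"
    by (rule minus_carrier_mat[OF that(2)])
  have CXCZ: "C * (X * (C * Z)) = C * Z" if "Z \<in> carrier_mat n n" for Z
    using arg_cong[OF x(1), of "\<lambda>M. M * Z"] carr that by (simp add: as)
  have XCXZ: "X * (C * (X * Z)) = X * Z" if "Z \<in> carrier_mat n n" for Z
    using arg_cong[OF x(2), of "\<lambda>M. M * Z"] carr that by (simp add: as)
  have CXXZ: "C * (X * (X * Z)) = X * Z" if "Z \<in> carrier_mat n n" for Z
    using arg_cong[OF x(3), of "\<lambda>M. M * Z"] carr that by (simp add: as)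
  have XCCZ: "X * (C * (C * Z)) = C * Z" if "Z \<in> carrier_mat n n" for Z
    using arg_cong[OF x(4), of "\<lambda>M. M * Z"] carr that by (simp add: as)
  have XD: "X * D = 0\<^sub>m n n"
    unfolding D_def using carr by (simp add: ma as XCXZ)
  have XDZ: "X * (D * Z) = 0\<^sub>m n n" if "Z \<in> carrier_mat n n" for Z
    using arg_cong[OF XD, of "\<lambda>M. M * Z"] carr that by (simp add: as)
  \<comment> \<open>This is the corner condition.\<close>
  have DXC: "D * (X * C) = D"
  proof -
    have "(1\<^sub>m n - C * X) * S = D" using carr unfolding D_def by (simp add: ma)
    then have "D - D * (X * C) = 0\<^sub>m n n" using corner carr by (simp add: ma)
    then have "D - D * (X * C) + D * (X * C) = D * (X * C)" using carr by simp
    moreover have "D - D * (X * C) + D * (X * C) = D"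
      using carr by (intro eq_matI) auto
    ultimately show ?thesis by simp
  qed
  have EtC: "Et * C = 0\<^sub>m n n"
  proof -
    have "C * X * D = 0\<^sub>m n n" using carr by (simp add: as XD)
    then have "transpose_mat D * (C * X) = 0\<^sub>m n n"
      using transpose_mult[of "C * X" n n D n] carr x(6) by simp
    then have "transpose_mat D * (C * X) * C = 0\<^sub>m n n" using carr by simp
    then have "transpose_mat D * C = 0\<^sub>m n n" using carr by (simp add: as x(1))
    moreover have "Et = transpose_mat X * transpose_mat D"
      unfolding Et_def using carr by (intro transpose_mult[of _ n n]) auto
    ultimately show ?thesis using carr by (simp add: as)
  qed
  have EtCZ: "Et * (C * Z) = 0\<^sub>m n n" if "Z \<in> carrier_mat n n" for Z
    using arg_cong[OF EtC, of "\<lambda>M. M * Z"] carr that by (simp add: as)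
  have EtX: "Et * X = 0\<^sub>m n n"
  proof -
    have "Et * X = Et * (C * (X * X))" using x by simp
    then show ?thesis using EtCZ carr by simp
  qed
  have CXEt: "C * (X * Et) = Et"
  proof -
    have "D * (X * (C * X)) = D * X" using carr x by simp
    then have "transpose_mat (D * X * (C * X)) = Et" using carr by (simp add: as Et_def)
    then show ?thesis
      using transpose_mult[of "D * X" n n "C * X" n] carr x(6) by (simp add: Et_def as)
  qed
  define Y where "Y = X * Et - X * S * X + (D * (X * X) - X * (C * (D * (X * X))))"
  have y: "Y \<in> carrier_mat n n" unfolding Y_def using carr by (auto intro!: mc)
  have CY: "C * Y = Et - C * X * S * X"
    unfolding Y_def using carr by (simp add: ma as mc CXEt CXCZ) (intro eq_matI; auto simp del: index_mult_mat(1))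
  have sX: "S * X = D * X + C * X * S * X"
    unfolding D_def using carr by (simp add: ma as) (intro eq_matI; auto simp del: index_mult_mat(1))
  have CYSX: "C * Y + S * X = Et + D * X"
    unfolding CY sX using carr by (intro eq_matI) (auto simp del: index_mult_mat(1))
  have CYS_sym: "transpose_mat (C * Y + S * X) = C * Y + S * X"
    unfolding CYSX Et_def using carr by (simp add: transpose_add[of _ n n] comm_add_mat[of _ n n])
  define Q where "Q = C * (X * (S * (X * X)))"
  have q: "Q \<in> carrier_mat n n" unfolding Q_def using carr by simp
  have CYX: "C * (Y * X) = 0\<^sub>m n n - Q"
    unfolding Q_def using arg_cong[OF CY, of "\<lambda>M. M * X"] carr y by (simp add: as ma EtX mc)
  have CXY: "C * (X * Y) = X * Et - X * S * X - X * (C * (D * (X * X)))"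
    unfolding Y_def using carr by (simp add: ma as mc CXXZ XDZ) (intro eq_matI; auto simp del: index_mult_mat(1))
  have sXX: "S * (X * X) = D * (X * X) + Q"
    unfolding D_def Q_def using carr by (simp add: ma as) (intro eq_matI; auto simp del: index_mult_mat(1))
  have eps2: "C * (X * Y + Y * X) + S * (X * X) = Y"
  proof -
    have "C * (X * Y + Y * X) + S * (X * X) = C * (X * Y) + C * (Y * X) + S * (X * X)"
      using carr y by (simp add: ma)
    also have "\<dots> = Y"
      unfolding CXY CYX sXX unfolding Y_def using carr q by (intro eq_matI) (auto simp: as simp del: index_mult_mat(1))
    finally show ?thesis .
  qed
  have YCC: "Y * (C * C) = - (X * (S * C)) + (D - X * (C * D))"
  proof -
    have "Y * (C * C) = X * (Et * (C * C)) - X * (S * (X * (C * C)))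
        + (D * (X * (X * (C * C))) - X * (C * (D * (X * (X * (C * C))))))"
      unfolding Y_def using carr by (simp add: ma as mc)
    also have "\<dots> = - (X * (S * C)) + (D - X * (C * D))"
      unfolding EtCZ[OF C] x(4) DXC using carr by (intro eq_matI) (auto simp del: index_mult_mat(1))
    finally show ?thesis .
  qed
  have XCD: "X * (C * D) = X * (C * S) - C * (X * S)"
    unfolding D_def using carr by (simp add: ma as mc XCCZ)
  have eps3: "X * (C * S + S * C) + Y * (C * C) = S"
  proof -
    have "X * (C * S + S * C) + Y * (C * C) = X * (C * S) + X * (S * C) + Y * (C * C)"
      using carr by (simp add: ma)
    also have "\<dots> = S"
      unfolding YCC XCD unfolding D_def using carr by (intro eq_matI) (auto simp: as simp del: index_mult_mat(1))
    finally show ?thesis .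
  qed
  define W where "W = dual_mat X Y"
  note dm = dual_mat_mult[of _ n n _ _ n]
  have CW: "dual_mat C S * W = dual_mat (C * X) (C * Y + S * X)"
    unfolding W_def using carr y by (simp add: dm)
  have "core_inverse (dual_mat C S) W"
    unfolding core_inverse_def
  proof (intro conjI)
    show "W \<in> carrier_mat (dim_row (dual_mat C S)) (dim_row (dual_mat C S))"
      using dual_mat_carrier[OF S, of C] dual_mat_carrier[OF y, of X] by (simp add: W_def)
    show "transpose_mat (dual_mat C S * W) = dual_mat C S * W"
      unfolding CW using carr y x(6) CYS_sym by (simp add: transpose_dual_mat[of _ n n])
    show "dual_mat C S * (W * W) = W"
      unfolding W_def using carr y eps2 x(3) by (simp add: dm)
    show "W * (dual_mat C S * dual_mat C S) = dual_mat C S"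
      unfolding W_def using carr y eps3 x(4) by (simp add: dm)
  qed
  then show thesis by (rule that)
qed

section \<open>Orthogonal decomposition into a nonsingular and a nilpotent part\<close>

text \<open>The reflection that exchanges \<open>y\<close> and the unit vector \<open>e\<^sub>p\<close>, along \<open>w = y - e\<^sub>p\<close>. Here
  \<open>w \<bullet> w = 2 * (1 - y\<^sub>p)\<close>, and this vanishes only for \<open>y = e\<^sub>p\<close>, where the identity does.\<close>
lemma householder_reflection:
  fixes y :: "real vec"
  assumes y: "y \<in> carrier_vec n" and p: "p < n" and unit: "(\<Sum>i<n. y $ i * y $ i) = 1"
  obtains U where "U \<in> carrier_mat n n" "transpose_mat U = U" "U * U = 1\<^sub>m n" "row U p = y"
proof (cases "y $ p = 1")
  case True
  have "(\<Sum>i\<in>{..<n} - {p}. y $ i * y $ i) = 0"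
    using unit True p by (simp add: sum_diff1)
  then have "\<forall>i\<in>{..<n} - {p}. y $ i * y $ i = 0"
    by (subst (asm) sum_nonneg_eq_0_iff) auto
  then have "row (1\<^sub>m n) p = y" using y p True by (intro eq_vecI) auto
  then show thesis by (intro that[of "1\<^sub>m n"]) auto
next
  case False
  define w where "w i = y $ i - (if i = p then 1 else 0)" for i
  define q where "q = (\<Sum>i<n. w i * w i)"
  have "q = (\<Sum>i<n. y $ i * y $ i - (if i = p then 2 * y $ i - 1 else 0))"
    unfolding q_def w_def by (intro sum.cong) (auto simp: algebra_simps)
  also have "\<dots> = 1 - (2 * y $ p - 1)" using p by (simp add: sum_subtractf unit)
  finally have q: "q = 2 * (1 - y $ p)" by simp
  then have q0: "q \<noteq> 0" using False by simp
  define c where "c = 2 / q"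
  define U where "U = mat n n (\<lambda>(i, j). (if i = j then 1 else 0) - c * w i * w j)"
  have U: "U \<in> carrier_mat n n" by (simp add: U_def)
  have UU: "U * U = 1\<^sub>m n"
  proof (rule eq_matI)
    fix i j assume "i < dim_row (1\<^sub>m n)" "j < dim_col (1\<^sub>m n)"
    then have ij: "i < n" "j < n" by auto
    let ?d = "\<lambda>i j. if i = j then 1 else (0 :: real)"
    have "(U * U) $$ (i, j) =
        (\<Sum>k<n. (?d i k - c * w i * w k) * (?d k j - c * w k * w j))"
      using ij by (simp add: U_def scalar_prod_def lessThan_atLeast0)
    also have "\<dots> = (\<Sum>k<n. (if k = i then ?d i j - c * w i * w j else 0)
        - (if k = j then c * w i * w j else 0) + c * w i * c * w j * (w k * w k))"
      by (intro sum.cong) (auto simp: algebra_simps)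
    also have "\<dots> = ?d i j - 2 * (c * w i * w j) + c * w i * c * w j * q"
      using ij by (simp add: sum.distrib sum_subtractf q_def sum_distrib_left)
    also have "\<dots> = ?d i j" using q0 by (simp add: c_def)
    finally show "(U * U) $$ (i, j) = 1\<^sub>m n $$ (i, j)" using ij by simp
  qed (use U in auto)
  have "row U p = y"
  proof (rule eq_vecI)
    fix j assume "j < dim_vec y"
    then have j: "j < n" using y by simp
    have "w p = - q / 2" using q by (simp add: w_def)
    then have "U $$ (p, j) = (if p = j then 1 else 0) + w j" using p j q0 by (simp add: U_def c_def)
    also have "\<dots> = y $ j" by (auto simp: w_def)
    finally show "row U p $ j = y $ j" using U p j by simp
  qed (use U y in auto)
  then show thesis using U UU by (intro that[of U]) (auto simp: U_def)
qed

lemma left_null_unit_vector: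
  fixes A :: "real mat"
  assumes A: "A \<in> carrier_mat n n" and det: "det A = 0"
  obtains y where "y \<in> carrier_vec n" "(\<Sum>i<n. y $ i * y $ i) = 1"
    "transpose_mat A *\<^sub>v y = 0\<^sub>v n"
proof -
  have At: "transpose_mat A \<in> carrier_mat n n" using A by simp
  obtain v where v: "v \<in> carrier_vec n" "v \<noteq> 0\<^sub>v n" "transpose_mat A *\<^sub>v v = 0\<^sub>v n"
    using det_0_iff_vec_prod_zero_field[OF At] det_transpose[OF A] det by auto
  define q where "q = (\<Sum>i<n. v $ i * v $ i)"
  obtain k where k: "k < n" "v $ k \<noteq> 0" using v(1,2) by (metis eq_vecI carrier_vecD index_zero_vec)
  have "0 < v $ k * v $ k" using k by (metis not_real_square_gt_zero)
  also have "\<dots> \<le> q" unfolding q_def using k by (intro member_le_sum) auto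
  finally have q: "q > 0" .
  let ?y = "(1 / sqrt q) \<cdot>\<^sub>v v"
  have "(\<Sum>i<n. ?y $ i * ?y $ i) = (\<Sum>i<n. v $ i * v $ i / q)"
    using v(1) q by (intro sum.cong) auto
  also have "\<dots> = 1" using q by (simp add: q_def flip: sum_divide_distrib)
  finally have "(\<Sum>i<n. ?y $ i * ?y $ i) = 1" .
  moreover have "transpose_mat A *\<^sub>v ?y = 0\<^sub>v n"
    unfolding mult_mat_vec[OF At v(1)] v(3) by (intro eq_vecI) auto
  ultimately show thesis using v(1) by (intro that[of ?y]) auto
qed

lemma zero_bottom_row_pow:
  fixes N b :: "'a :: comm_ring_1 mat"
  assumes N: "N \<in> carrier_mat s s" and b: "b \<in> carrier_mat s t"
  shows "four_block_mat N b (0\<^sub>m t s) (0\<^sub>m t t) ^\<^sub>m Suc j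
    = four_block_mat (N ^\<^sub>m Suc j) (N ^\<^sub>m j * b) (0\<^sub>m t s) (0\<^sub>m t t)"
proof (induction j)
  case 0
  show ?case using N b by simp
next
  case (Suc j)
  have pc: "N ^\<^sub>m Suc j \<in> carrier_mat s s" "N ^\<^sub>m j * b \<in> carrier_mat s t"
    using N b pow_carrier_mat[OF N, of j] by auto
  show ?case
    unfolding pow_mat.simps(2)[of "four_block_mat N b (0\<^sub>m t s) (0\<^sub>m t t)" "Suc j"] Suc
    using N b pc
    by (subst mult_four_block_mat[of _ s s _ t _ t _ _ s _ t]) auto
qed

text \<open>Moving the dividing line of a block matrix, so that a zero last row joins the nilpotent block.\<close>
lemma four_block_regroup:
  fixes T1 T2 N b :: "'a :: zero mat"
  assumes "T1 \<in> carrier_mat r r" "T2 \<in> carrier_mat r s" "N \<in> carrier_mat s s"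
    "b \<in> carrier_mat (r + s) 1"
  obtains T2' b2 where "T2' \<in> carrier_mat r (s + 1)" "b2 \<in> carrier_mat s 1"
    "four_block_mat (four_block_mat T1 T2 (0\<^sub>m s r) N) b (0\<^sub>m 1 (r + s)) (0\<^sub>m 1 1)
     = four_block_mat T1 T2' (0\<^sub>m (s + 1) r) (four_block_mat N b2 (0\<^sub>m 1 s) (0\<^sub>m 1 1))"
proof
  define T2' where "T2' = mat r (s + 1) (\<lambda>(i, j). if j < s then T2 $$ (i, j) else b $$ (i, 0))"
  define b2 where "b2 = mat s 1 (\<lambda>(i, j). b $$ (r + i, 0))"
  show "T2' \<in> carrier_mat r (s + 1)" "b2 \<in> carrier_mat s 1" by (auto simp: T2'_def b2_def)
  show "four_block_mat (four_block_mat T1 T2 (0\<^sub>m s r) N) b (0\<^sub>m 1 (r + s)) (0\<^sub>m 1 1)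
     = four_block_mat T1 T2' (0\<^sub>m (s + 1) r) (four_block_mat N b2 (0\<^sub>m 1 s) (0\<^sub>m 1 1))"
    using assms by (intro eq_matI) (auto simp: T2'_def b2_def)
qed

lemma invertible_matE:
  fixes T :: "'a :: field mat"
  assumes "invertible_mat T" "T \<in> carrier_mat n n"
  obtains Ti where "Ti \<in> carrier_mat n n" "T * Ti = 1\<^sub>m n" "Ti * T = 1\<^sub>m n"
proof -
  obtain B where B: "T * B = 1\<^sub>m (dim_row T)" "B * T = 1\<^sub>m (dim_row B)"
    using assms(1) by (auto simp: invertible_mat_def inverts_mat_def)
  have "dim_row B = n" "dim_col B = n"
    using arg_cong[OF B(1), of dim_col] arg_cong[OF B(2), of dim_col] assms(2) by auto
  then show thesis using B assms(2) by (intro that[of B]) auto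
qed

lemma core_ep_decomposition_nonsingular:
  fixes A :: "real mat"
  assumes A: "A \<in> carrier_mat n n" and det: "det A \<noteq> 0"
  shows "\<exists>r s k U T1 T2 N. r + s = n \<and> U \<in> carrier_mat n n \<and>
    U * transpose_mat U = 1\<^sub>m n \<and> transpose_mat U * U = 1\<^sub>m n \<and>
    T1 \<in> carrier_mat r r \<and> T2 \<in> carrier_mat r s \<and> N \<in> carrier_mat s s \<and>
    invertible_mat T1 \<and> N ^\<^sub>m k = 0\<^sub>m s s \<and>
    A = U * four_block_mat T1 T2 (0\<^sub>m s r) N * transpose_mat U"
proof -
  obtain Ai where Ai: "Ai \<in> carrier_mat n n" "Ai * A = 1\<^sub>m n" "A * Ai = 1\<^sub>m n"
    using det_non_zero_imp_unit[OF A det] by (auto simp: Units_def ring_mat_def)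
  have inv: "invertible_mat A"
    using Ai A by (auto simp: invertible_mat_def inverts_mat_def)
  have fb: "four_block_mat A (0\<^sub>m n 0) (0\<^sub>m 0 n) (0\<^sub>m 0 0) = A"
    using A by (intro eq_matI) auto
  have z: "(0\<^sub>m 0 0 :: real mat) ^\<^sub>m 0 = 0\<^sub>m 0 0" by (intro eq_matI) auto
  show ?thesis
    by (rule exI[of _ n], rule exI[of _ 0], rule exI[of _ 0], rule exI[of _ "1\<^sub>m n"],
        rule exI[of _ A], rule exI[of _ "0\<^sub>m n 0"], rule exI[of _ "0\<^sub>m 0 0"])
      (use inv fb z A in simp)
qed

text \<open>Induction on the size. A nonsingular matrix is its own block \<open>T1\<close>. A singular one has a unit vector
  \<open>y\<close> with \<open>y\<^sup>T * A = 0\<close>; a reflection that has \<open>y\<close> as its last row conjugates \<open>A\<close> to a matrix whose last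
  row is zero. The induction hypothesis is applied to the leading principal block, and the zero row is
  added to the nilpotent part.\<close>
lemma core_ep_decomposition:
  fixes A :: "real mat"
  assumes "A \<in> carrier_mat n n"
  shows "\<exists>r s k U T1 T2 N. r + s = n \<and> U \<in> carrier_mat n n \<and>
    U * transpose_mat U = 1\<^sub>m n \<and> transpose_mat U * U = 1\<^sub>m n \<and>
    T1 \<in> carrier_mat r r \<and> T2 \<in> carrier_mat r s \<and> N \<in> carrier_mat s s \<and>
    invertible_mat T1 \<and> N ^\<^sub>m k = 0\<^sub>m s s \<and>
    A = U * four_block_mat T1 T2 (0\<^sub>m s r) N * transpose_mat U"
  using assms
proof (induction n arbitrary: A)
  case (0 A)
  then show ?case by (intro core_ep_decomposition_nonsingular) (auto simp: det_dim_zero)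
next
  case (Suc p A)
  let ?n = "Suc p"
  show ?case
  proof (cases "det A = 0")
    case False
    with Suc.prems show ?thesis by (rule core_ep_decomposition_nonsingular)
  next
    case True
    note A = Suc.prems
    obtain y where y: "y \<in> carrier_vec ?n" "(\<Sum>i<?n. y $ i * y $ i) = 1"
      "transpose_mat A *\<^sub>v y = 0\<^sub>v ?n"
      by (rule left_null_unit_vector[OF A True])
    obtain U where U: "U \<in> carrier_mat ?n ?n" "transpose_mat U = U" "U * U = 1\<^sub>m ?n" "row U p = y"
      by (rule householder_reflection[OF y(1) _ y(2), of p]) auto
    define B where "B = U * A * U"
    have B: "B \<in> carrier_mat ?n ?n" using U A by (simp add: B_def)
    have rowUA: "row (U * A) p = 0\<^sub>v ?n"
    proof (rule eq_vecI)
      fix j assume "j < dim_vec (0\<^sub>v ?n :: real vec)"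
      then have j: "j < ?n" by simp
      have "row (U * A) p $ j = y \<bullet> col A j" using U A j by simp
      also have "\<dots> = (transpose_mat A *\<^sub>v y) $ j"
        using A y(1) j comm_scalar_prod[of y ?n "col A j"] by simp
      finally show "row (U * A) p $ j = 0\<^sub>v ?n $ j" using y(3) j by simp
    qed (use A in auto)
    have Brow: "B $$ (p, j) = 0" if "j < ?n" for j
    proof -
      have "B $$ (p, j) = row (U * A) p \<bullet> col U j" using U(1) A that by (simp add: B_def del: assoc_mult_mat)
      then show ?thesis unfolding rowUA using U(1) that by simp
    qed
    define A' where "A' = mat p p (\<lambda>(i, j). B $$ (i, j))"
    define a where "a = mat p 1 (\<lambda>(i, j). B $$ (i, p))"
    have A': "A' \<in> carrier_mat p p" and a: "a \<in> carrier_mat p 1" by (auto simp: A'_def a_def)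
    have Bfb: "B = four_block_mat A' a (0\<^sub>m 1 p) (0\<^sub>m 1 1)"
    proof (rule eq_matI)
      fix i j assume "i < dim_row (four_block_mat A' a (0\<^sub>m 1 p) (0\<^sub>m 1 1))"
        "j < dim_col (four_block_mat A' a (0\<^sub>m 1 p) (0\<^sub>m 1 1))"
      then have ij: "i < ?n" "j < ?n" using A' by auto
      show "B $$ (i, j) = four_block_mat A' a (0\<^sub>m 1 p) (0\<^sub>m 1 1) $$ (i, j)"
        using ij A' a Brow[OF ij(2)] by (cases "i = p"; cases "j = p") (auto simp: A'_def a_def)
    qed (use A' B in auto)
    obtain r s k V T1 T2 N where IH: "r + s = p" "V \<in> carrier_mat p p"
      "V * transpose_mat V = 1\<^sub>m p" "transpose_mat V * V = 1\<^sub>m p"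
      "T1 \<in> carrier_mat r r" "T2 \<in> carrier_mat r s" "N \<in> carrier_mat s s"
      "invertible_mat T1" "N ^\<^sub>m k = 0\<^sub>m s s"
      "A' = V * four_block_mat T1 T2 (0\<^sub>m s r) N * transpose_mat V"
      using Suc.IH[OF A'] by metis
    define M where "M = four_block_mat T1 T2 (0\<^sub>m s r) N"
    have M: "M \<in> carrier_mat p p" using IH by (auto simp: M_def)
    define b where "b = transpose_mat V * a"
    have b: "b \<in> carrier_mat (r + s) 1" using IH(1,2) a by (simp add: b_def)
    obtain T2' b2 where re: "T2' \<in> carrier_mat r (s + 1)" "b2 \<in> carrier_mat s 1"
      "four_block_mat M b (0\<^sub>m 1 (r + s)) (0\<^sub>m 1 1)
       = four_block_mat T1 T2' (0\<^sub>m (s + 1) r) (four_block_mat N b2 (0\<^sub>m 1 s) (0\<^sub>m 1 1))"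
      unfolding M_def by (rule four_block_regroup[OF IH(5-7) b])
    define N' where "N' = four_block_mat N b2 (0\<^sub>m 1 s) (0\<^sub>m 1 1)"
    have N': "N' \<in> carrier_mat (s + 1) (s + 1)"
      unfolding N'_def by (rule four_block_carrier_mat[OF IH(7) zero_carrier_mat])
    have N'0: "N' ^\<^sub>m Suc k = 0\<^sub>m (s + 1) (s + 1)"
      unfolding N'_def zero_bottom_row_pow[OF IH(7) re(2)] pow_mat.simps(2)[of N k] IH(9)
      using IH(7) re(2) by simp
    define Q where "Q = four_block_mat V (0\<^sub>m p 1) (0\<^sub>m 1 p) (1\<^sub>m 1)"
    have Q: "Q \<in> carrier_mat ?n ?n" unfolding Q_def using four_block_carrier_mat[OF IH(2) one_carrier_mat[of 1]] by simp
    have Qt: "transpose_mat Q = four_block_mat (transpose_mat V) (0\<^sub>m p 1) (0\<^sub>m 1 p) (1\<^sub>m 1)"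
      unfolding Q_def using IH(2) by (subst transpose_four_block_mat[of _ p p _ 1 _ 1]) auto
    have Qt_c: "transpose_mat Q \<in> carrier_mat ?n ?n" using Q by simp
    have QQ: "Q * transpose_mat Q = 1\<^sub>m ?n" "transpose_mat Q * Q = 1\<^sub>m ?n"
      unfolding Qt unfolding Q_def using IH(2-4)
      by (subst mult_four_block_mat[of _ p p _ 1 _ 1 _ _ p _ 1]; simp)+
    have VVa: "V * (transpose_mat V * a) = a"
      using IH(2,3) a assoc_mult_mat[of V p p "transpose_mat V" p a 1] by simp
    have "Q * four_block_mat M b (0\<^sub>m 1 p) (0\<^sub>m 1 1) * transpose_mat Q
      = four_block_mat (V * M) (V * b) (0\<^sub>m 1 p) (0\<^sub>m 1 1) * transpose_mat Q"
      unfolding Q_def using IH(1,2) M b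
      by (subst mult_four_block_mat[of _ p p _ 1 _ 1 _ _ p _ 1]) auto
    also have "\<dots> = B"
      unfolding Qt Bfb IH(10) M_def[symmetric] using IH(1,2) M b VVa a
      by (subst mult_four_block_mat[of _ p p _ 1 _ 1 _ _ p _ 1]) (auto simp: b_def)
    finally have BQ: "B = Q * four_block_mat T1 T2' (0\<^sub>m (s + 1) r) N' * transpose_mat Q"
      using re(3) IH(1) by (simp add: N'_def)
    note as = assoc_mult_mat[of _ ?n ?n _ ?n _ ?n]
    have UQt: "transpose_mat (U * Q) = transpose_mat Q * U"
      using transpose_mult[OF U(1) Q] U(2) by simp
    have Uc: "U * (U * Z) = Z" if "Z \<in> carrier_mat ?n ?n" for Z
      using arg_cong[OF U(3), of "\<lambda>M. M * Z"] U(1) that by (simp add: as)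
    have Qc: "Q * (transpose_mat Q * Z) = Z" "transpose_mat Q * (Q * Z) = Z"
      if "Z \<in> carrier_mat ?n ?n" for Z
      using arg_cong[OF QQ(1), of "\<lambda>M. M * Z"] arg_cong[OF QQ(2), of "\<lambda>M. M * Z"] Q Qt_c that
      by (simp_all add: as)
    let ?F = "four_block_mat T1 T2' (0\<^sub>m (s + 1) r) N'"
    have F: "?F \<in> carrier_mat ?n ?n" using four_block_carrier_mat[OF IH(5) N'] IH(1) by simp
    have "A = U * B * U"
      unfolding B_def using U(1,3) A by (simp add: as Uc)
    then have "A = U * Q * ?F * transpose_mat (U * Q)"
      unfolding UQt BQ using U(1) Q Qt_c F by (simp add: as)
    moreover have "U * Q * transpose_mat (U * Q) = 1\<^sub>m ?n" "transpose_mat (U * Q) * (U * Q) = 1\<^sub>m ?n"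
      unfolding UQt using U(1,3) Q Qt_c QQ by (simp_all add: as Qc Uc)
    moreover have "U * Q \<in> carrier_mat ?n ?n" "r + (s + 1) = ?n" using U(1) Q IH(1) by auto
    ultimately show ?thesis using IH(5,8) re(1) N' N'0 by blast
  qed
qed

section \<open>Sums and powers of block matrices\<close>

lemma mat_sum_mult_right:
  fixes f :: "'i \<Rightarrow> 'a :: semiring_0 mat"
  assumes f: "\<And>i. i \<in> I \<Longrightarrow> f i \<in> carrier_mat nr n" and A: "A \<in> carrier_mat n nc"
  shows "mat_sum nr n f I * A = mat_sum nr nc (\<lambda>i. f i * A) I"
proof (rule eq_matI)
  fix p q
  assume "p < dim_row (mat_sum nr nc (\<lambda>i. f i * A) I)" "q < dim_col (mat_sum nr nc (\<lambda>i. f i * A) I)"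
  then have pq: "p < nr" "q < nc" by (auto simp: mat_sum_def)
  have "(mat_sum nr n f I * A) $$ (p, q) = (\<Sum>k\<in>{0..<n}. (\<Sum>i\<in>I. f i $$ (p, k)) * A $$ (k, q))"
    using A pq by (simp add: scalar_prod_def mat_sum_def carrier_matD)
  also have "\<dots> = (\<Sum>i\<in>I. \<Sum>k\<in>{0..<n}. f i $$ (p, k) * A $$ (k, q))"
    by (simp add: sum_distrib_right sum.swap[of _ I])
  also have "\<dots> = (\<Sum>i\<in>I. (f i * A) $$ (p, q))"
    using A pq carrier_matD[OF f] by (intro sum.cong refl) (simp add: scalar_prod_def)
  finally show "(mat_sum nr n f I * A) $$ (p, q) = mat_sum nr nc (\<lambda>i. f i * A) I $$ (p, q)"
    using pq by (simp add: mat_sum_def)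
qed (use A in \<open>auto simp: mat_sum_def\<close>)

lemma mat_sum_mult_left:
  fixes f :: "'i \<Rightarrow> 'a :: semiring_0 mat"
  assumes f: "\<And>i. i \<in> I \<Longrightarrow> f i \<in> carrier_mat n nc" and A: "A \<in> carrier_mat nr n"
  shows "A * mat_sum n nc f I = mat_sum nr nc (\<lambda>i. A * f i) I"
proof (rule eq_matI)
  fix p q
  assume "p < dim_row (mat_sum nr nc (\<lambda>i. A * f i) I)" "q < dim_col (mat_sum nr nc (\<lambda>i. A * f i) I)"
  then have pq: "p < nr" "q < nc" by (auto simp: mat_sum_def)
  have "(A * mat_sum n nc f I) $$ (p, q) = (\<Sum>k\<in>{0..<n}. A $$ (p, k) * (\<Sum>i\<in>I. f i $$ (k, q)))"
    using A pq by (simp add: scalar_prod_def mat_sum_def carrier_matD)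
  also have "\<dots> = (\<Sum>i\<in>I. \<Sum>k\<in>{0..<n}. A $$ (p, k) * f i $$ (k, q))"
    by (simp add: sum_distrib_left sum.swap[of _ I])
  also have "\<dots> = (\<Sum>i\<in>I. (A * f i) $$ (p, q))"
    using A pq carrier_matD[OF f] by (intro sum.cong refl) (simp add: scalar_prod_def)
  finally show "(A * mat_sum n nc f I) $$ (p, q) = mat_sum nr nc (\<lambda>i. A * f i) I $$ (p, q)"
    using pq by (simp add: mat_sum_def)
qed (use A in \<open>auto simp: mat_sum_def\<close>)

lemma mat_sum_cong:
  assumes "\<And>i. i \<in> I \<Longrightarrow> f i = g i"
  shows "mat_sum nr nc f I = mat_sum nr nc g I"
  using assms by (auto simp: mat_sum_def intro!: cong_mat)

lemma mat_sum_four_block: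
  assumes "\<And>i. i \<in> I \<Longrightarrow> a i \<in> carrier_mat r r'" "\<And>i. i \<in> I \<Longrightarrow> b i \<in> carrier_mat r s'"
    "\<And>i. i \<in> I \<Longrightarrow> c i \<in> carrier_mat s r'" "\<And>i. i \<in> I \<Longrightarrow> d i \<in> carrier_mat s s'"
  shows "mat_sum (r + s) (r' + s') (\<lambda>i. four_block_mat (a i) (b i) (c i) (d i)) I
    = four_block_mat (mat_sum r r' a I) (mat_sum r s' b I) (mat_sum s r' c I) (mat_sum s s' d I)"
proof (rule eq_matI; (simp add: mat_sum_def; fail)?)
  fix i j
  assume "i < dim_row (four_block_mat (mat_sum r r' a I) (mat_sum r s' b I) (mat_sum s r' c I) (mat_sum s s' d I))"
    "j < dim_col (four_block_mat (mat_sum r r' a I) (mat_sum r s' b I) (mat_sum s r' c I) (mat_sum s s' d I))"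
  then have ij: "i < r + s" "j < r' + s'" by (auto simp: mat_sum_def)
  have "four_block_mat (a k) (b k) (c k) (d k) $$ (i, j) =
      (if i < r then if j < r' then a k $$ (i, j) else b k $$ (i, j - r')
       else if j < r' then c k $$ (i - r, j) else d k $$ (i - r, j - r'))" if "k \<in> I" for k
    using assms(1,4)[OF that] ij by auto
  then show "mat_sum (r + s) (r' + s') (\<lambda>i. four_block_mat (a i) (b i) (c i) (d i)) I $$ (i, j)
    = four_block_mat (mat_sum r r' a I) (mat_sum r s' b I) (mat_sum s r' c I) (mat_sum s s' d I) $$ (i, j)"
    using ij by (auto simp: mat_sum_def)
qed

text \<open>The off-diagonal block of the power of a block upper triangular matrix. For \<open>k = m\<close> it is the matrix
  \<open>Tt\<close> of the block equation, for \<open>k = i - 1\<close> the matrix \<open>F i\<close>.\<close>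
definition upper_pow_corner :: "nat \<Rightarrow> nat \<Rightarrow> 'a :: semiring_1 mat \<Rightarrow> 'a mat \<Rightarrow> 'a mat \<Rightarrow> nat \<Rightarrow> 'a mat" where
  "upper_pow_corner r s T1 T2 N k = mat_sum r s (\<lambda>j. T1 ^\<^sub>m j * T2 * N ^\<^sub>m (k - 1 - j)) {0..<k}"

lemma upper_pow_corner_carrier [simp]: "upper_pow_corner r s T1 T2 N k \<in> carrier_mat r s"
  by (simp add: upper_pow_corner_def)

lemma upper_block_pow:
  fixes T1 :: "'a :: comm_ring_1 mat"
  assumes T1: "T1 \<in> carrier_mat r r" and T2: "T2 \<in> carrier_mat r s" and N: "N \<in> carrier_mat s s"
  shows "four_block_mat T1 T2 (0\<^sub>m s r) N ^\<^sub>m k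
    = four_block_mat (T1 ^\<^sub>m k) (upper_pow_corner r s T1 T2 N k) (0\<^sub>m s r) (N ^\<^sub>m k)"
proof (induction k)
  case 0
  have "upper_pow_corner r s T1 T2 N 0 = 0\<^sub>m r s"
    by (intro eq_matI) (auto simp: upper_pow_corner_def mat_sum_def)
  then show ?case using T1 N by simp
next
  case (Suc k)
  let ?F = "upper_pow_corner r s T1 T2 N"
  have pc: "T1 ^\<^sub>m j \<in> carrier_mat r r" "N ^\<^sub>m j \<in> carrier_mat s s" for j using T1 N by auto
  have term_c: "T1 ^\<^sub>m i * T2 * N ^\<^sub>m j \<in> carrier_mat r s" for i j
    by (rule mult_carrier_mat[OF mult_carrier_mat[OF pc(1) T2] pc(2)])
  have shift: "T1 ^\<^sub>m j * T2 * N ^\<^sub>m (k - 1 - j) * N = T1 ^\<^sub>m j * T2 * N ^\<^sub>m (Suc k - 1 - j)"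
    if "j < k" for j
  proof -
    have "T1 ^\<^sub>m j * T2 * N ^\<^sub>m (k - 1 - j) * N = T1 ^\<^sub>m j * T2 * (N ^\<^sub>m (k - 1 - j) * N)"
      by (rule assoc_mult_mat[OF mult_carrier_mat[OF pc(1) T2] pc(2) N])
    also have "N ^\<^sub>m (k - 1 - j) * N = N ^\<^sub>m Suc (k - 1 - j)" by simp
    also have "Suc (k - 1 - j) = Suc k - 1 - j" using that by simp
    finally show ?thesis .
  qed
  have FN: "?F k * N = mat_sum r s (\<lambda>j. T1 ^\<^sub>m j * T2 * N ^\<^sub>m (Suc k - 1 - j)) {0..<k}"
    unfolding upper_pow_corner_def
    by (subst mat_sum_mult_right[OF term_c N]) (rule mat_sum_cong, rule shift, simp)
  have last: "T1 ^\<^sub>m k * T2 = T1 ^\<^sub>m k * T2 * N ^\<^sub>m (Suc k - 1 - k)"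
    using pc[of k] T2 N by simp
  have "T1 ^\<^sub>m k * T2 + ?F k * N = ?F (Suc k)"
    unfolding FN unfolding upper_pow_corner_def
    by (subst last, intro eq_matI) (use pc[of k] T2 in \<open>auto simp: mat_sum_def\<close>)
  moreover have "four_block_mat (T1 ^\<^sub>m k) (?F k) (0\<^sub>m s r) (N ^\<^sub>m k) * four_block_mat T1 T2 (0\<^sub>m s r) N
    = four_block_mat (T1 ^\<^sub>m k * T1) (T1 ^\<^sub>m k * T2 + ?F k * N) (0\<^sub>m s r) (N ^\<^sub>m k * N)"
    unfolding mult_four_block_mat[OF pc(1) upper_pow_corner_carrier zero_carrier_mat pc(2)
        T1 T2 zero_carrier_mat N] right_mult_zero_mat[OF upper_pow_corner_carrier]
      right_mult_zero_mat[OF pc(2)] left_mult_zero_mat[OF T1] left_mult_zero_mat[OF T2]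
      right_add_zero_mat[OF mult_carrier_mat[OF pc(1) T1]]
      left_add_zero_mat[OF mult_carrier_mat[OF pc(2) N]]
    by simp
  ultimately show ?case using Suc by simp
qed

lemma pow_mult_inverse_pow:
  fixes T :: "'a :: comm_ring_1 mat"
  assumes T: "T \<in> carrier_mat r r" and Ti: "Ti \<in> carrier_mat r r" and TTi: "T * Ti = 1\<^sub>m r"
  shows "T ^\<^sub>m i * Ti ^\<^sub>m (i + j) = Ti ^\<^sub>m j"
proof (induction i)
  case 0
  show ?case using T Ti pow_carrier_mat[OF Ti, of j] by simp
next
  case (Suc i)
  have pc: "T ^\<^sub>m k \<in> carrier_mat r r" "Ti ^\<^sub>m k \<in> carrier_mat r r" for k using T Ti by auto
  have "T ^\<^sub>m Suc i * Ti ^\<^sub>m (Suc i + j) = T ^\<^sub>m i * (T * Ti) * Ti ^\<^sub>m (i + j)"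
    using pow_mat_Suc_left[OF Ti, of "i + j"] T Ti pc
    by (simp add: assoc_mult_mat[of _ r r _ r _ r])
  then show ?case unfolding TTi Suc[symmetric] right_mult_one_mat[OF pc(1)] .
qed

text \<open>The inverse computed by elimination is the inverse at hand, since inverses are unique.\<close>
lemma mat_powi_neg:
  assumes T: "(T :: 'a :: field mat) \<in> carrier_mat r r" and Ti: "Ti \<in> carrier_mat r r"
    and inv: "T * Ti = 1\<^sub>m r" "Ti * T = 1\<^sub>m r" and k: "k < 0"
  shows "mat_powi T k = Ti ^\<^sub>m nat (- k)"
proof -
  have "T \<in> Units (ring_mat TYPE('a) r undefined)"
    using T Ti inv by (auto simp: Units_def ring_mat_def)
  then obtain J where J: "mat_inverse T = Some J" using mat_inverse(1)[OF T] by fastforce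
  have j: "T * J = 1\<^sub>m r" "J \<in> carrier_mat r r" using mat_inverse(2)[OF T J] by auto
  have "Ti = Ti * (T * J)" using j Ti by simp
  also have "\<dots> = Ti * T * J" using T Ti j(2) by simp
  finally have "J = Ti" using inv(2) j(2) by simp
  then show ?thesis using J k by (simp add: mat_powi_def)
qed

text \<open>If the nilpotent part has died out, the range of \<open>C\<close> is spanned by the leading coordinates, so the
  orthogonal projector onto it is diagonal and the core inverse can be read off.\<close>
lemma upper_block_core_inverse:
  fixes P F :: "real mat"
  assumes P: "P \<in> carrier_mat r r" and J: "J \<in> carrier_mat r r"
    and inv: "P * J = 1\<^sub>m r" "J * P = 1\<^sub>m r" and F: "F \<in> carrier_mat r s"
  defines "C \<equiv> four_block_mat P F (0\<^sub>m s r) (0\<^sub>m s s)"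
    and "X \<equiv> four_block_mat J (0\<^sub>m r s) (0\<^sub>m s r) (0\<^sub>m s s)"
  shows "core_inverse C X"
    and "1\<^sub>m (r + s) - C * X = four_block_mat (0\<^sub>m r r) (0\<^sub>m r s) (0\<^sub>m s r) (1\<^sub>m s)"
    and "1\<^sub>m (r + s) - X * C = four_block_mat (0\<^sub>m r r) (- (J * F)) (0\<^sub>m s r) (1\<^sub>m s)"
proof -
  note mfb = mult_four_block_mat[of _ r r _ s _ s _ _ r _ s]
  have CX: "C * X = four_block_mat (1\<^sub>m r) (0\<^sub>m r s) (0\<^sub>m s r) (0\<^sub>m s s)"
    unfolding C_def X_def using P J F inv by (subst mfb) auto
  have XC: "X * C = four_block_mat (1\<^sub>m r) (J * F) (0\<^sub>m s r) (0\<^sub>m s s)"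
    unfolding C_def X_def using P J F inv by (subst mfb) auto
  have c: "C \<in> carrier_mat (r + s) (r + s)" "X \<in> carrier_mat (r + s) (r + s)"
    using P J by (auto simp: C_def X_def)
  have "C * X * X = X"
    unfolding CX unfolding X_def using J by (subst mfb) auto
  moreover have "X * C * C = C"
    unfolding XC unfolding C_def using P J F by (subst mfb) auto
  moreover have "transpose_mat (C * X) = C * X"
    unfolding CX by (subst transpose_four_block_mat[of _ r r _ s _ s]) auto
  ultimately show "core_inverse C X"
    using c by (auto simp: core_inverse_def)
  show "1\<^sub>m (r + s) - C * X = four_block_mat (0\<^sub>m r r) (0\<^sub>m r s) (0\<^sub>m s r) (1\<^sub>m s)"
    unfolding CX by (intro eq_matI) auto
  show "1\<^sub>m (r + s) - X * C = four_block_mat (0\<^sub>m r r) (- (J * F)) (0\<^sub>m s r) (1\<^sub>m s)"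
    unfolding XC using J F by (intro eq_matI) auto
qed

lemma block_corner_eq:
  fixes L G S1 :: "real mat"
  assumes "S1 \<in> carrier_mat r r" "S2 \<in> carrier_mat r s" "S3 \<in> carrier_mat s r" "S4 \<in> carrier_mat s s"
    and G: "G \<in> carrier_mat r s"
  shows "four_block_mat (0\<^sub>m r r) (0\<^sub>m r s) (0\<^sub>m s r) (1\<^sub>m s) * four_block_mat S1 S2 S3 S4
      * four_block_mat (0\<^sub>m r r) (- G) (0\<^sub>m s r) (1\<^sub>m s)
    = four_block_mat (0\<^sub>m r r) (0\<^sub>m r s) (0\<^sub>m s r) (S4 - S3 * G)"
proof -
  note mfb = mult_four_block_mat[of _ r r _ s _ s _ _ r _ s]
  have "four_block_mat (0\<^sub>m r r) (0\<^sub>m r s) (0\<^sub>m s r) (1\<^sub>m s) * four_block_mat S1 S2 S3 S4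
      = four_block_mat (0\<^sub>m r r) (0\<^sub>m r s) S3 S4"
    using assms by (subst mfb) auto
  moreover have "four_block_mat (0\<^sub>m r r) (0\<^sub>m r s) S3 S4 * four_block_mat (0\<^sub>m r r) (- G) (0\<^sub>m s r) (1\<^sub>m s)
      = four_block_mat (0\<^sub>m r r) (0\<^sub>m r s) (0\<^sub>m s r) (S3 * (- G) + S4)"
    using assms by (subst mfb) auto
  moreover have "S3 * (- G) + S4 = S4 - S3 * G"
    using assms by (intro eq_matI) auto
  ultimately show ?thesis by simp
qed

lemma four_block_zero_iff:
  assumes D: "D \<in> carrier_mat s s"
  shows "four_block_mat (0\<^sub>m r r) (0\<^sub>m r s) (0\<^sub>m s r) D = 0\<^sub>m (r + s) (r + s) \<longleftrightarrow> D = 0\<^sub>m s s"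
proof
  assume eq: "four_block_mat (0\<^sub>m r r) (0\<^sub>m r s) (0\<^sub>m s r) D = 0\<^sub>m (r + s) (r + s)"
  show "D = 0\<^sub>m s s"
  proof (rule eq_matI)
    fix i j assume "i < dim_row (0\<^sub>m s s)" "j < dim_col (0\<^sub>m s s)"
    then have ij: "i < s" "j < s" by auto
    have "D $$ (i, j) = four_block_mat (0\<^sub>m r r) (0\<^sub>m r s) (0\<^sub>m s r) D $$ (r + i, r + j)"
      using ij D by simp
    then show "D $$ (i, j) = 0\<^sub>m s s $$ (i, j)" unfolding eq using ij by simp
  qed (use D in auto)
qed simp

section \<open>Orthogonal conjugation and block coordinates\<close>

text \<open>For orthogonal \<open>U\<close> this is an automorphism of the matrix ring that commutes with transposition, so all
  notions involved can be computed in the coordinates of the block decomposition.\<close>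
definition orth_conj :: "'a :: comm_ring_1 mat \<Rightarrow> 'a mat \<Rightarrow> 'a mat" where
  "orth_conj U M = U * M * transpose_mat U"

context
  fixes U :: "'a :: comm_ring_1 mat" and n :: nat
  assumes U: "U \<in> carrier_mat n n" and UUt: "U * transpose_mat U = 1\<^sub>m n"
    and UtU: "transpose_mat U * U = 1\<^sub>m n"
begin

lemma orth_conj_carrier: "M \<in> carrier_mat n n \<Longrightarrow> orth_conj U M \<in> carrier_mat n n"
  using U by (auto simp: orth_conj_def)

lemma transpose_orth_cancel:
  assumes "Z \<in> carrier_mat n n"
  shows "transpose_mat U * (U * Z) = Z" "U * (transpose_mat U * Z) = Z"
  using arg_cong[OF UtU, of "\<lambda>M. M * Z"] arg_cong[OF UUt, of "\<lambda>M. M * Z"] U assms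
  by (simp_all add: assoc_mult_mat[of _ n n _ n _ n])

lemma orth_conj_mult:
  assumes M: "M \<in> carrier_mat n n" and K: "K \<in> carrier_mat n n"
  shows "orth_conj U M * orth_conj U K = orth_conj U (M * K)"
  using U M K unfolding orth_conj_def
  by (simp add: assoc_mult_mat[of _ n n _ n _ n] transpose_orth_cancel)

lemma orth_conj_one: "orth_conj U (1\<^sub>m n) = 1\<^sub>m n"
  using U UUt by (simp add: orth_conj_def)

lemma orth_conj_pow:
  assumes M: "M \<in> carrier_mat n n"
  shows "orth_conj U M ^\<^sub>m k = orth_conj U (M ^\<^sub>m k)"
proof (induction k)
  case 0
  then show ?case using M orth_conj_carrier[OF M] by (simp add: orth_conj_one)
next
  case (Suc k)
  then show ?case using orth_conj_mult[OF pow_carrier_mat[OF M, of k] M] by simp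
qed

lemma orth_conj_minus:
  assumes M: "M \<in> carrier_mat n n" and K: "K \<in> carrier_mat n n"
  shows "orth_conj U (M - K) = orth_conj U M - orth_conj U K"
  using U M K unfolding orth_conj_def
  by (simp add: mult_minus_distrib_mat[of _ n n _ n] minus_mult_distrib_mat[of _ n n _ _ n])

lemma orth_conj_transpose:
  assumes M: "M \<in> carrier_mat n n"
  shows "transpose_mat (orth_conj U M) = orth_conj U (transpose_mat M)"
proof -
  have "transpose_mat (orth_conj U M) = U * transpose_mat (U * M)"
    unfolding orth_conj_def using transpose_mult[of "U * M" n n "transpose_mat U" n] U M by simp
  then show ?thesis
    unfolding orth_conj_def using transpose_mult[of U n n M n] U M
    by (simp add: assoc_mult_mat[of _ n n _ n _ n])
qed

lemma orth_conj_mat_sum: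
  assumes f: "\<And>i. i \<in> I \<Longrightarrow> f i \<in> carrier_mat n n"
  shows "orth_conj U (mat_sum n n f I) = mat_sum n n (\<lambda>i. orth_conj U (f i)) I"
proof -
  have "U * mat_sum n n f I = mat_sum n n (\<lambda>i. U * f i) I"
    by (rule mat_sum_mult_left[OF f U])
  moreover have "mat_sum n n (\<lambda>i. U * f i) I * transpose_mat U
      = mat_sum n n (\<lambda>i. U * f i * transpose_mat U) I"
    using U f by (intro mat_sum_mult_right) auto
  ultimately show ?thesis by (simp add: orth_conj_def)
qed

lemma orth_conj_inverse:
  assumes M: "M \<in> carrier_mat n n"
  shows "transpose_mat U * orth_conj U M * U = M"
    "orth_conj U (transpose_mat U * M * U) = M"
  using U M UtU UUt unfolding orth_conj_def
  by (simp_all add: assoc_mult_mat[of _ n n _ n _ n] transpose_orth_cancel)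

lemma orth_conj_eq_zero_iff:
  assumes M: "M \<in> carrier_mat n n"
  shows "orth_conj U M = 0\<^sub>m n n \<longleftrightarrow> M = 0\<^sub>m n n"
proof
  assume "orth_conj U M = 0\<^sub>m n n"
  then have "transpose_mat U * 0\<^sub>m n n * U = M" using orth_conj_inverse(1)[OF M] by simp
  then show "M = 0\<^sub>m n n" using U by simp
next
  assume "M = 0\<^sub>m n n"
  then show "orth_conj U M = 0\<^sub>m n n" using U by (simp add: orth_conj_def)
qed

lemma orth_conj_core_inverse:
  assumes C: "C \<in> carrier_mat n n" and X: "core_inverse C X"
  shows "core_inverse (orth_conj U C) (orth_conj U X)"
proof -
  note x = core_inverse_inner[OF C X]
  show ?thesis
    using C x orth_conj_carrier[OF C] orth_conj_carrier[OF x(5)]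
    by (simp add: core_inverse_def orth_conj_mult orth_conj_transpose)
qed

end

text \<open>The sum is the derivative of \<open>M ^ m\<close> in direction \<open>K\<close>. Only its lower blocks are made explicit, because
  only they survive multiplication by \<open>1 - C * X\<close>.\<close>
lemma upper_block_power_derivative:
  fixes T1 :: "'a :: comm_ring_1 mat"
  assumes T1: "T1 \<in> carrier_mat r r" and T2: "T2 \<in> carrier_mat r s" and N: "N \<in> carrier_mat s s"
    and B1: "B1 \<in> carrier_mat r r" and B2: "B2 \<in> carrier_mat r s"
    and B3: "B3 \<in> carrier_mat s r" and B4: "B4 \<in> carrier_mat s s"
  defines "M \<equiv> four_block_mat T1 T2 (0\<^sub>m s r) N" and "K \<equiv> four_block_mat B1 B2 B3 B4"
    and "F \<equiv> upper_pow_corner r s T1 T2 N"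
  obtains S1 S2 where "S1 \<in> carrier_mat r r" "S2 \<in> carrier_mat r s"
    "mat_sum (r + s) (r + s) (\<lambda>i. M ^\<^sub>m (m - i) * K * M ^\<^sub>m (i - 1)) {1..m}
     = four_block_mat S1 S2
         (mat_sum s r (\<lambda>i. N ^\<^sub>m (m - i) * B3 * T1 ^\<^sub>m (i - 1)) {1..m})
         (mat_sum s s (\<lambda>i. N ^\<^sub>m (m - i) * B3 * F (i - 1) + N ^\<^sub>m (m - i) * B4 * N ^\<^sub>m (i - 1)) {1..m})"
proof -
  have F: "F j \<in> carrier_mat r s" for j by (simp add: F_def)
  have pc: "T1 ^\<^sub>m j \<in> carrier_mat r r" "N ^\<^sub>m j \<in> carrier_mat s s" for j using T1 N by auto
  note mc = mult_carrier_mat add_carrier_mat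
  note mfb = mult_four_block_mat[of _ r r _ s _ s _ _ r _ s]
  define P where "P a = T1 ^\<^sub>m a * B1 + F a * B3" for a
  define Q where "Q a = T1 ^\<^sub>m a * B2 + F a * B4" for a
  have P: "P a \<in> carrier_mat r r" and Q: "Q a \<in> carrier_mat r s" for a
    unfolding P_def Q_def using pc[of a] F[of a] B1 B2 B3 B4 by auto
  have pows: "M ^\<^sub>m j = four_block_mat (T1 ^\<^sub>m j) (F j) (0\<^sub>m s r) (N ^\<^sub>m j)" for j
    unfolding M_def F_def by (rule upper_block_pow[OF T1 T2 N])
  have trm: "M ^\<^sub>m a * K * M ^\<^sub>m b = four_block_mat (P a * T1 ^\<^sub>m b) (P a * F b + Q a * N ^\<^sub>m b)
      (N ^\<^sub>m a * B3 * T1 ^\<^sub>m b) (N ^\<^sub>m a * B3 * F b + N ^\<^sub>m a * B4 * N ^\<^sub>m b)" for a b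
  proof -
    have "M ^\<^sub>m a * K = four_block_mat (P a) (Q a) (N ^\<^sub>m a * B3) (N ^\<^sub>m a * B4)"
      unfolding pows K_def P_def Q_def
      using pc[of a] F[of a] B1 B2 B3 B4 by (subst mfb) auto
    moreover have "four_block_mat (P a) (Q a) (N ^\<^sub>m a * B3) (N ^\<^sub>m a * B4)
        * four_block_mat (T1 ^\<^sub>m b) (F b) (0\<^sub>m s r) (N ^\<^sub>m b)
      = four_block_mat (P a * T1 ^\<^sub>m b + Q a * 0\<^sub>m s r) (P a * F b + Q a * N ^\<^sub>m b)
      (N ^\<^sub>m a * B3 * T1 ^\<^sub>m b + N ^\<^sub>m a * B4 * 0\<^sub>m s r) (N ^\<^sub>m a * B3 * F b + N ^\<^sub>m a * B4 * N ^\<^sub>m b)"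
      by (rule mult_four_block_mat[OF P Q mult_carrier_mat[OF pc(2) B3] mult_carrier_mat[OF pc(2) B4]
            pc(1) F zero_carrier_mat pc(2)])
    moreover have "P a * T1 ^\<^sub>m b + Q a * 0\<^sub>m s r = P a * T1 ^\<^sub>m b"
      using P[of a] Q[of a] pc[of b] by simp
    moreover have "N ^\<^sub>m a * B3 * T1 ^\<^sub>m b + N ^\<^sub>m a * B4 * 0\<^sub>m s r = N ^\<^sub>m a * B3 * T1 ^\<^sub>m b"
      using pc[of a] pc[of b] B3 B4 mult_carrier_mat[OF mult_carrier_mat[OF pc(2) B3] pc(1), of a b]
      by (simp add: right_mult_zero_mat[OF mult_carrier_mat[OF pc(2) B4]] del: assoc_mult_mat)
    ultimately show ?thesis unfolding pows[of b] by simp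
  qed
  show thesis
  proof (rule that)
    show "mat_sum r r (\<lambda>i. P (m - i) * T1 ^\<^sub>m (i - 1)) {1..m} \<in> carrier_mat r r"
      "mat_sum r s (\<lambda>i. P (m - i) * F (i - 1) + Q (m - i) * N ^\<^sub>m (i - 1)) {1..m} \<in> carrier_mat r s"
      by simp_all
    show "mat_sum (r + s) (r + s) (\<lambda>i. M ^\<^sub>m (m - i) * K * M ^\<^sub>m (i - 1)) {1..m}
     = four_block_mat (mat_sum r r (\<lambda>i. P (m - i) * T1 ^\<^sub>m (i - 1)) {1..m})
         (mat_sum r s (\<lambda>i. P (m - i) * F (i - 1) + Q (m - i) * N ^\<^sub>m (i - 1)) {1..m})
         (mat_sum s r (\<lambda>i. N ^\<^sub>m (m - i) * B3 * T1 ^\<^sub>m (i - 1)) {1..m})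
         (mat_sum s s (\<lambda>i. N ^\<^sub>m (m - i) * B3 * F (i - 1) + N ^\<^sub>m (m - i) * B4 * N ^\<^sub>m (i - 1)) {1..m})"
      unfolding trm
      by (rule mat_sum_four_block)
        (rule mc P Q F pc B3 B4)+
  qed
qed

text \<open>In block coordinates \<open>1 - C * X\<close> selects the lower rows, and \<open>1 - X * C\<close> has the last block column
  \<open>(- T1\<^sup>-\<^sup>m * F m, 1)\<close>. With the lower blocks \<open>S3\<close>, \<open>S4\<close> of \<open>S\<close> the corner is therefore the single block
  \<open>S4 - S3 * T1\<^sup>-\<^sup>m * F m\<close>, and absorbing \<open>T1\<^sup>-\<^sup>m\<close> into the powers of \<open>T1\<close> in \<open>S3\<close> gives the negative exponents.\<close>
lemma corner_zero_iff_block_equation: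
  fixes A B :: "real mat"
  assumes rs: "r + s = n" and U: "U \<in> carrier_mat n n"
    and UUt: "U * transpose_mat U = 1\<^sub>m n" and UtU: "transpose_mat U * U = 1\<^sub>m n"
    and T1: "T1 \<in> carrier_mat r r" and T2: "T2 \<in> carrier_mat r s" and N: "N \<in> carrier_mat s s"
    and B1: "B1 \<in> carrier_mat r r" and B2: "B2 \<in> carrier_mat r s"
    and B3: "B3 \<in> carrier_mat s r" and B4: "B4 \<in> carrier_mat s s"
    and A: "A = U * four_block_mat T1 T2 (0\<^sub>m s r) N * transpose_mat U"
    and B: "B = U * four_block_mat B1 B2 B3 B4 * transpose_mat U"
    and inv: "invertible_mat T1" and nil: "N ^\<^sub>m m = 0\<^sub>m s s"
  defines "F \<equiv> upper_pow_corner r s T1 T2 N"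
    and "S \<equiv> mat_sum n n (\<lambda>i. A ^\<^sub>m (m - i) * B * A ^\<^sub>m (i - 1)) {1..m}"
    and "X \<equiv> core_ep_inverse (A ^\<^sub>m m)"
  shows "core_inverse (A ^\<^sub>m m) X"
    and "(1\<^sub>m n - A ^\<^sub>m m * X) * S * (1\<^sub>m n - X * A ^\<^sub>m m) = 0\<^sub>m n n \<longleftrightarrow>
      mat_sum s s (\<lambda>i. N ^\<^sub>m (m - i) * B3 * mat_powi T1 (int i - int m - 1) * F m) {1..m} =
      mat_sum s s (\<lambda>i. N ^\<^sub>m (m - i) * B3 * F (i - 1) + N ^\<^sub>m (m - i) * B4 * N ^\<^sub>m (i - 1)) {1..m}"
proof -
  define M where "M = four_block_mat T1 T2 (0\<^sub>m s r) N"
  define K where "K = four_block_mat B1 B2 B3 B4"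
  have M: "M \<in> carrier_mat n n" and K: "K \<in> carrier_mat n n"
    using rs T1 N B1 B4 by (auto simp: M_def K_def)
  have AM: "A = orth_conj U M" and BK: "B = orth_conj U K"
    by (simp_all add: A B M_def K_def orth_conj_def)
  note cj = orth_conj_mult[OF U UUt UtU] orth_conj_pow[OF U UUt UtU] orth_conj_carrier[OF U UUt UtU]
  have F: "F j \<in> carrier_mat r s" for j by (simp add: F_def)
  obtain Ti where Ti: "Ti \<in> carrier_mat r r" "T1 * Ti = 1\<^sub>m r" "Ti * T1 = 1\<^sub>m r"
    by (rule invertible_matE[OF inv T1])
  have pc: "T1 ^\<^sub>m j \<in> carrier_mat r r" "N ^\<^sub>m j \<in> carrier_mat s s" "Ti ^\<^sub>m j \<in> carrier_mat r r"
    "M ^\<^sub>m j \<in> carrier_mat n n" for j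
    using T1 N Ti(1) M by auto
  have inv_m: "T1 ^\<^sub>m m * Ti ^\<^sub>m m = 1\<^sub>m r" "Ti ^\<^sub>m m * T1 ^\<^sub>m m = 1\<^sub>m r"
    using pow_mult_inverse_pow[OF T1 Ti(1,2), of m 0] pow_mult_inverse_pow[OF Ti(1) T1 Ti(3), of m 0]
      T1 Ti(1) by simp_all
  have C: "M ^\<^sub>m m = four_block_mat (T1 ^\<^sub>m m) (F m) (0\<^sub>m s r) (0\<^sub>m s s)"
    unfolding M_def F_def upper_block_pow[OF T1 T2 N] nil ..
  define X0 where "X0 = four_block_mat (Ti ^\<^sub>m m) (0\<^sub>m r s) (0\<^sub>m s r) (0\<^sub>m s s)"
  have X0: "X0 \<in> carrier_mat n n" using pc(3)[of m] rs by (auto simp: X0_def)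
  note ub = upper_block_core_inverse[OF pc(1) pc(3) inv_m F[of m], folded C X0_def, unfolded rs]
  have Am: "A ^\<^sub>m m = orth_conj U (M ^\<^sub>m m)" unfolding AM by (rule cj(2)[OF M])
  have Amc: "A ^\<^sub>m m \<in> carrier_mat n n" unfolding Am by (rule cj(3)[OF pc(4)])
  have ci: "core_inverse (A ^\<^sub>m m) (orth_conj U X0)"
    unfolding Am by (rule orth_conj_core_inverse[OF U UUt UtU pc(4) ub(1)])
  have X: "X = orth_conj U X0" unfolding X_def by (rule core_ep_inverse_eqI[OF Amc ci])
  show "core_inverse (A ^\<^sub>m m) X" unfolding X by (rule ci)
  define S0 where "S0 = mat_sum n n (\<lambda>i. M ^\<^sub>m (m - i) * K * M ^\<^sub>m (i - 1)) {1..m}"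
  have S0c: "S0 \<in> carrier_mat n n" by (simp add: S0_def)
  have S: "S = orth_conj U S0"
  proof -
    have trm: "M ^\<^sub>m a * K * M ^\<^sub>m b \<in> carrier_mat n n" for a b
      by (rule mult_carrier_mat[OF mult_carrier_mat[OF pc(4) K] pc(4)])
    have "A ^\<^sub>m a * B * A ^\<^sub>m b = orth_conj U (M ^\<^sub>m a * K * M ^\<^sub>m b)" for a b
      unfolding AM BK cj(2)[OF M] cj(1)[OF pc(4) K] cj(1)[OF mult_carrier_mat[OF pc(4) K] pc(4)] ..
    then show ?thesis unfolding S_def S0_def orth_conj_mat_sum[OF U UUt UtU trm] by simp
  qed
  define S3 where "S3 = mat_sum s r (\<lambda>i. N ^\<^sub>m (m - i) * B3 * T1 ^\<^sub>m (i - 1)) {1..m}"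
  define S4 where "S4 = mat_sum s s
    (\<lambda>i. N ^\<^sub>m (m - i) * B3 * F (i - 1) + N ^\<^sub>m (m - i) * B4 * N ^\<^sub>m (i - 1)) {1..m}"
  have S34: "S3 \<in> carrier_mat s r" "S4 \<in> carrier_mat s s" by (auto simp: S3_def S4_def)
  obtain S1 S2 where S12: "S1 \<in> carrier_mat r r" "S2 \<in> carrier_mat r s"
    and S0: "S0 = four_block_mat S1 S2 S3 S4"
  proof (rule upper_block_power_derivative[OF T1 T2 N B1 B2 B3 B4, of m])
    fix S1 S2 assume "S1 \<in> carrier_mat r r" "S2 \<in> carrier_mat r s"
      "mat_sum (r + s) (r + s) (\<lambda>i. four_block_mat T1 T2 (0\<^sub>m s r) N ^\<^sub>m (m - i)
          * four_block_mat B1 B2 B3 B4 * four_block_mat T1 T2 (0\<^sub>m s r) N ^\<^sub>m (i - 1)) {1..m}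
        = four_block_mat S1 S2
         (mat_sum s r (\<lambda>i. N ^\<^sub>m (m - i) * B3 * T1 ^\<^sub>m (i - 1)) {1..m})
         (mat_sum s s (\<lambda>i. N ^\<^sub>m (m - i) * B3 * upper_pow_corner r s T1 T2 N (i - 1)
            + N ^\<^sub>m (m - i) * B4 * N ^\<^sub>m (i - 1)) {1..m})"
    then show thesis
      by (intro that) (simp_all only: S0_def M_def K_def S3_def S4_def F_def rs)
  qed
  define G where "G = Ti ^\<^sub>m m * F m"
  have G: "G \<in> carrier_mat r s" unfolding G_def by (rule mult_carrier_mat[OF pc(3) F])
  define L R where "L = 1\<^sub>m n - M ^\<^sub>m m * X0" and "R = 1\<^sub>m n - X0 * M ^\<^sub>m m"
  have lr: "L \<in> carrier_mat n n" "R \<in> carrier_mat n n"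
    unfolding L_def R_def using pc(4)[of m] X0 by (auto intro!: minus_carrier_mat)
  have L': "1\<^sub>m n - A ^\<^sub>m m * X = orth_conj U L"
    unfolding X Am L_def using pc(4)[of m] X0
    by (simp add: cj orth_conj_minus[OF U UUt UtU] orth_conj_one[OF U UUt UtU])
  have R': "1\<^sub>m n - X * A ^\<^sub>m m = orth_conj U R"
    unfolding X Am R_def using pc(4)[of m] X0
    by (simp add: cj orth_conj_minus[OF U UUt UtU] orth_conj_one[OF U UUt UtU])
  have "(1\<^sub>m n - A ^\<^sub>m m * X) * S * (1\<^sub>m n - X * A ^\<^sub>m m) = orth_conj U (L * S0 * R)"
    unfolding L' R' S using lr S0c mult_carrier_mat[OF lr(1) S0c] by (simp add: cj(1) del: assoc_mult_mat)
  also have "\<dots> = 0\<^sub>m n n \<longleftrightarrow> L * S0 * R = 0\<^sub>m n n"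
    by (rule orth_conj_eq_zero_iff[OF U UUt UtU mult_carrier_mat[OF mult_carrier_mat[OF lr(1) S0c] lr(2)]])
  also have "L * S0 * R = four_block_mat (0\<^sub>m r r) (0\<^sub>m r s) (0\<^sub>m s r) (S4 - S3 * G)"
    unfolding L_def R_def ub(2,3) S0 G_def[symmetric] by (rule block_corner_eq[OF S12 S34 G])
  also have "\<dots> = 0\<^sub>m n n \<longleftrightarrow> S4 - S3 * G = 0\<^sub>m s s"
    unfolding rs[symmetric] using S34 G by (intro four_block_zero_iff minus_carrier_mat) auto
  also have "\<dots> \<longleftrightarrow> S3 * G = S4"
  proof
    assume *: "S4 - S3 * G = 0\<^sub>m s s"
    have "S4 = S4 - S3 * G + S3 * G" using S34 G by (intro eq_matI) auto
    then show "S3 * G = S4" unfolding * using S34 G by simp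
  next
    assume "S3 * G = S4"
    then show "S4 - S3 * G = 0\<^sub>m s s" using S34 by (intro eq_matI) auto
  qed
  also have "S3 * G = mat_sum s s
      (\<lambda>i. N ^\<^sub>m (m - i) * B3 * mat_powi T1 (int i - int m - 1) * F m) {1..m}"
  proof -
    have "S3 * G = mat_sum s s (\<lambda>i. N ^\<^sub>m (m - i) * B3 * T1 ^\<^sub>m (i - 1) * G) {1..m}"
      unfolding S3_def
      by (rule mat_sum_mult_right[OF mult_carrier_mat[OF mult_carrier_mat[OF pc(2) B3] pc(1)] G])
    also have "\<dots> = mat_sum s s
      (\<lambda>i. N ^\<^sub>m (m - i) * B3 * mat_powi T1 (int i - int m - 1) * F m) {1..m}"
    proof (rule mat_sum_cong)
      fix i assume i: "i \<in> {1..m}"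
      have NB: "N ^\<^sub>m (m - i) * B3 \<in> carrier_mat s r" by (rule mult_carrier_mat[OF pc(2) B3])
      have "mat_powi T1 (int i - int m - 1) = Ti ^\<^sub>m (m + 1 - i)"
      proof -
        have "int i - int m - 1 < 0" "nat (- (int i - int m - 1)) = m + 1 - i" using i by auto
        then show ?thesis using mat_powi_neg[OF T1 Ti, of "int i - int m - 1"] by simp
      qed
      also have "\<dots> = T1 ^\<^sub>m (i - 1) * Ti ^\<^sub>m m"
        using pow_mult_inverse_pow[OF T1 Ti(1,2), of "i - 1" "m + 1 - i"] i by simp
      finally have powi: "mat_powi T1 (int i - int m - 1) = T1 ^\<^sub>m (i - 1) * Ti ^\<^sub>m m" .
      show "N ^\<^sub>m (m - i) * B3 * T1 ^\<^sub>m (i - 1) * G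
          = N ^\<^sub>m (m - i) * B3 * mat_powi T1 (int i - int m - 1) * F m"
        unfolding powi G_def
        using assoc_mult_mat[OF NB pc(1) G, of "i - 1"] assoc_mult_mat[OF pc(1) pc(3) F, of "i - 1" m m]
          assoc_mult_mat[OF NB mult_carrier_mat[OF pc(1) pc(3)] F, of "i - 1" m m]
        by (simp add: G_def del: assoc_mult_mat)
    qed
    finally show ?thesis .
  qed
  finally show "(1\<^sub>m n - A ^\<^sub>m m * X) * S * (1\<^sub>m n - X * A ^\<^sub>m m) = 0\<^sub>m n n \<longleftrightarrow>
      mat_sum s s (\<lambda>i. N ^\<^sub>m (m - i) * B3 * mat_powi T1 (int i - int m - 1) * F m) {1..m} =
      mat_sum s s (\<lambda>i. N ^\<^sub>m (m - i) * B3 * F (i - 1) + N ^\<^sub>m (m - i) * B4 * N ^\<^sub>m (i - 1)) {1..m}"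
    unfolding S4_def .
qed

text \<open>That already the index is an exponent of nilpotency follows from \<open>A ^ m = A ^ (m + 1) * Z\<close>: iteration
  gives \<open>A ^ m = A ^ (m + k) * Z ^ k\<close>, and for \<open>N ^ k = 0\<close> the lower rows of the right-hand side vanish.\<close>
lemma core_ep_decomposition_index:
  fixes A :: "real mat"
  assumes A: "A \<in> carrier_mat n n"
  obtains r s U T1 T2 N where "r + s = n" "U \<in> carrier_mat n n"
    "U * transpose_mat U = 1\<^sub>m n" "transpose_mat U * U = 1\<^sub>m n"
    "T1 \<in> carrier_mat r r" "T2 \<in> carrier_mat r s" "N \<in> carrier_mat s s"
    "invertible_mat T1" "N ^\<^sub>m mat_index A = 0\<^sub>m s s"
    "A = U * four_block_mat T1 T2 (0\<^sub>m s r) N * transpose_mat U"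
proof -
  obtain r s k U T1 T2 N where d: "r + s = n" "U \<in> carrier_mat n n"
    "U * transpose_mat U = 1\<^sub>m n" "transpose_mat U * U = 1\<^sub>m n"
    "T1 \<in> carrier_mat r r" "T2 \<in> carrier_mat r s" "N \<in> carrier_mat s s"
    "invertible_mat T1" "N ^\<^sub>m k = 0\<^sub>m s s"
    "A = U * four_block_mat T1 T2 (0\<^sub>m s r) N * transpose_mat U"
    using core_ep_decomposition[OF A] by metis
  define M where "M = four_block_mat T1 T2 (0\<^sub>m s r) N"
  have M: "M \<in> carrier_mat n n"
    unfolding M_def d(1)[symmetric] by (rule four_block_carrier_mat[OF d(5,7)])
  have AM: "A = orth_conj U M" by (simp add: d(10) M_def orth_conj_def)
  let ?m = "mat_index A"
  obtain Z where Z: "Z \<in> carrier_mat n n" "A ^\<^sub>m ?m = A ^\<^sub>m (?m + 1) * Z"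
    using mat_index_pow_factor[OF A] .
  have pc: "A ^\<^sub>m j \<in> carrier_mat n n" "Z ^\<^sub>m j \<in> carrier_mat n n" "M ^\<^sub>m j \<in> carrier_mat n n" for j
    using A Z(1) M by auto
  note as = assoc_mult_mat[of _ n n _ n _ n]
  have fac: "A ^\<^sub>m ?m = A ^\<^sub>m (j + ?m) * Z ^\<^sub>m j" for j
  proof (induction j)
    case 0
    show ?case using right_mult_one_mat[OF pc(1)[of ?m]] Z(1) by simp
  next
    case (Suc j)
    have "A ^\<^sub>m (j + ?m) = A ^\<^sub>m j * (A ^\<^sub>m (?m + 1) * Z)"
      unfolding pow_mat_add[OF A, of j ?m] Z(2)[symmetric] ..
    also have "\<dots> = A ^\<^sub>m (j + (?m + 1)) * Z"
      unfolding pow_mat_add[OF A, of j "?m + 1"] by (rule assoc_mult_mat[OF pc(1) pc(1) Z(1), symmetric])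
    finally have "A ^\<^sub>m ?m = A ^\<^sub>m (Suc j + ?m) * Z * Z ^\<^sub>m j" using Suc.IH by simp
    also have "\<dots> = A ^\<^sub>m (Suc j + ?m) * Z ^\<^sub>m Suc j"
      unfolding pow_mat_Suc_left[OF Z(1)] by (rule assoc_mult_mat[OF pc(1) Z(1) pc(2)])
    finally show ?case .
  qed
  have pow_A: "A ^\<^sub>m j = orth_conj U (M ^\<^sub>m j)" for j
    unfolding AM by (rule orth_conj_pow[OF d(2-4) M])
  define Y where "Y = transpose_mat U * Z ^\<^sub>m k * U"
  have Y: "Y \<in> carrier_mat n n" using d(2) pc(2)[of k] by (simp add: Y_def)
  have ZY: "Z ^\<^sub>m k = orth_conj U Y"
    unfolding Y_def by (rule orth_conj_inverse(2)[OF d(2-4) pc(2), symmetric])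
  have "orth_conj U (M ^\<^sub>m ?m) = orth_conj U (M ^\<^sub>m (k + ?m) * Y)"
    using fac[of k] pow_A[of ?m] pow_A[of "k + ?m"] orth_conj_mult[OF d(2-4) pc(3) Y]
    unfolding ZY by metis
  then have "transpose_mat U * orth_conj U (M ^\<^sub>m ?m) * U
      = transpose_mat U * orth_conj U (M ^\<^sub>m (k + ?m) * Y) * U" by (rule arg_cong)
  then have MY: "M ^\<^sub>m ?m = M ^\<^sub>m (k + ?m) * Y"
    unfolding orth_conj_inverse(1)[OF d(2-4) pc(3)]
      orth_conj_inverse(1)[OF d(2-4) mult_carrier_mat[OF pc(3) Y]] .
  have Nk: "N ^\<^sub>m (k + ?m) = 0\<^sub>m s s"
    unfolding pow_mat_add[OF d(7)] d(9)
    by (rule left_mult_zero_mat[OF pow_carrier_mat[OF d(7)]])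
  have "N ^\<^sub>m ?m = 0\<^sub>m s s"
  proof (rule eq_matI)
    fix i j assume "i < dim_row (0\<^sub>m s s)" "j < dim_col (0\<^sub>m s s)"
    then have ij: "i < s" "j < s" by auto
    have F: "upper_pow_corner r s T1 T2 N q \<in> carrier_mat r s" for q by simp
    have row0: "row (M ^\<^sub>m (k + ?m)) (r + i) = 0\<^sub>v n"
      unfolding M_def upper_block_pow[OF d(5-7)] Nk
      using d(1,5) ij F[of "k + ?m"] by (intro eq_vecI) auto
    have "(N ^\<^sub>m ?m) $$ (i, j) = (M ^\<^sub>m ?m) $$ (r + i, r + j)"
      unfolding M_def upper_block_pow[OF d(5-7)] using d(5,7) ij by simp
    also have "\<dots> = row (M ^\<^sub>m (k + ?m)) (r + i) \<bullet> col Y (r + j)"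
      unfolding MY using pc(3)[of "k + ?m"] Y ij d(1) by (intro index_mult_mat(1)) auto
    also have "\<dots> = 0" unfolding row0
      by (rule scalar_prod_left_zero, rule col_carrier_vec[OF _ Y]) (use ij d(1) in simp)
    finally show "(N ^\<^sub>m ?m) $$ (i, j) = 0\<^sub>m s s $$ (i, j)" using ij by simp
  qed (use d(7) in auto)
  then show thesis by (rule that[OF d(1-8) _ d(10)])
qed

section \<open>Existence of the dual core-EP inverse\<close>

lemma is_dual_core_ep_inverse_iff:
  assumes A: "A \<in> carrier_mat n n" and B: "B \<in> carrier_mat n n"
  shows "is_dual_core_ep_inverse (dual_mat A B) X \<longleftrightarrow> X \<in> carrier_mat n n \<and>
    transpose_mat (dual_mat A B * X) = dual_mat A B * X \<and> dual_mat A B * X ^\<^sub>m 2 = X \<and>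
    X * dual_mat A B ^\<^sub>m Suc (mat_index A) = dual_mat A B ^\<^sub>m mat_index A"
  using carrier_matD(1)[OF dual_mat_carrier[OF B, of A]]
  by (simp add: is_dual_core_ep_inverse_def map_std_part_dual_mat[OF A B] Let_def)

text \<open>Necessity comes from the inner inverse of the dual power that a dual core-EP inverse provides.
  For sufficiency, the corner condition lifts the core inverse of \<open>A ^ m\<close> to the dual power, from which the
  dual core-EP inverse is obtained as \<open>A' ^ (m - 1) * W\<close>; for \<open>m = 0\<close> this formula is meaningless, but then
  \<open>A\<close> and hence the dual matrix is invertible.\<close>
lemma dual_core_ep_inverse_exists_iff_corner:
  fixes A B :: "real mat"
  assumes A: "A \<in> carrier_mat n n" and B: "B \<in> carrier_mat n n" and m: "mat_index A = m"
    and X: "core_inverse (A ^\<^sub>m m) X"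
  defines "S \<equiv> mat_sum n n (\<lambda>i. A ^\<^sub>m (m - i) * B * A ^\<^sub>m (i - 1)) {1..m}"
  shows "(\<exists>Y. is_dual_core_ep_inverse (dual_mat A B) Y)
    \<longleftrightarrow> (1\<^sub>m n - A ^\<^sub>m m * X) * S * (1\<^sub>m n - X * A ^\<^sub>m m) = 0\<^sub>m n n"
proof -
  let ?D = "dual_mat A B"
  have D: "?D \<in> carrier_mat n n" using B by simp
  have C: "A ^\<^sub>m m \<in> carrier_mat n n" using A by simp
  have S: "S \<in> carrier_mat n n" by (simp add: S_def)
  have Dm: "?D ^\<^sub>m m = dual_mat (A ^\<^sub>m m) S" unfolding S_def by (rule dual_mat_pow[OF A B])
  note x = core_inverse_inner[OF C X]
  note iff = is_dual_core_ep_inverse_iff[OF A B, unfolded m]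
  show ?thesis
  proof
    assume "\<exists>Y. is_dual_core_ep_inverse ?D Y"
    then obtain Y where Y: "Y \<in> carrier_mat n n" "?D * Y ^\<^sub>m 2 = Y" "Y * ?D ^\<^sub>m Suc m = ?D ^\<^sub>m m"
      using iff by blast
    have "?D * Y ^\<^sub>m Suc m \<in> carrier_mat n n"
      by (rule mult_carrier_mat[OF D pow_carrier_mat[OF Y(1)]])
    then show "(1\<^sub>m n - A ^\<^sub>m m * X) * S * (1\<^sub>m n - X * A ^\<^sub>m m) = 0\<^sub>m n n"
      by (rule dual_inner_inverse_imp_corner_zero[OF C S x(5) x(1)])
        (rule core_ep_inner_inverse_of_power[OF D Y, unfolded Dm])
  next
    assume corner: "(1\<^sub>m n - A ^\<^sub>m m * X) * S * (1\<^sub>m n - X * A ^\<^sub>m m) = 0\<^sub>m n n"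
    show "\<exists>Y. is_dual_core_ep_inverse ?D Y"
    proof (cases m)
      case (Suc k)
      obtain W where "core_inverse (dual_mat (A ^\<^sub>m m) S) W"
        by (rule corner_zero_imp_dual_core_inverse[OF C S X corner])
      then have W: "core_inverse (?D ^\<^sub>m Suc k) W" by (simp only: Dm[symmetric] Suc[symmetric])
      show ?thesis
        unfolding iff Suc
        by (rule exI[of _ "?D ^\<^sub>m k * W"], intro conjI) (rule core_ep_inverse_from_power[OF D W])+
    next
      case 0
      obtain Z where Z: "Z \<in> carrier_mat n n" "A ^\<^sub>m m = A ^\<^sub>m (m + 1) * Z"
        by (rule mat_index_pow_factor[OF A, unfolded m])
      have AZ: "A * Z = 1\<^sub>m n" using Z 0 A by simp
      have ZA: "Z * A = 1\<^sub>m n" by (rule mat_mult_left_right_inverse[OF A Z(1) AZ])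
      have ZBZ: "Z * B * Z \<in> carrier_mat n n" using Z B by simp
      define Y where "Y = dual_mat Z (- (Z * B * Z))"
      have Y: "Y \<in> carrier_mat n n" using ZBZ by (simp add: Y_def)
      note as = assoc_mult_mat[of _ n n _ n _ n]
      have one: "dual_mat (1\<^sub>m n) (0\<^sub>m n n) = 1\<^sub>m n"
        by (intro eq_matI) (auto simp: dual_mat_def)
      have "A * (Z * B * Z) = A * Z * (B * Z)" using A B Z(1) by (simp add: as)
      then have 1: "A * - (Z * B * Z) + B * Z = 0\<^sub>m n n"
        unfolding AZ using A B Z(1) by (intro eq_matI) auto
      have "Z * B * Z * A = Z * B * (Z * A)" using A B Z(1) by (simp add: as)
      then have 2: "Z * B + - (Z * B * Z) * A = 0\<^sub>m n n"
        unfolding ZA using A B Z(1) by (intro eq_matI) auto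
      have DY: "?D * Y = 1\<^sub>m n"
        unfolding Y_def using A B Z(1) ZBZ AZ 1 one by (simp add: dual_mat_mult[of _ n n _ _ n])
      have YD: "Y * ?D = 1\<^sub>m n"
        unfolding Y_def using A B Z(1) ZBZ ZA 2 one by (simp add: dual_mat_mult[of _ n n _ _ n])
      have "?D * Y ^\<^sub>m 2 = ?D * Y * Y" using D Y by (simp add: pow_mat_2[OF Y] as)
      also have "\<dots> = Y" unfolding DY using Y by simp
      finally have DYY: "?D * Y ^\<^sub>m 2 = Y" .
      have "is_dual_core_ep_inverse ?D Y"
        unfolding iff using DY DYY YD D Y by (simp add: 0)
      then show ?thesis ..
    qed
  qed
qed

theorem theorem3p3:
  fixes n m :: nat and A B S :: "real mat" and Ahat :: "dual_real mat"
  assumes "A \<in> carrier_mat n n" and "B \<in> carrier_mat n n"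
    and "Ahat = dual_mat A B"
    and "mat_index A = m"
    and "S = mat_sum n n (\<lambda>i. A ^\<^sub>m (m - i) * B * A ^\<^sub>m (i - 1)) {1..m}"
  shows
    "((\<exists>X. is_dual_core_ep_inverse Ahat X)
      \<longleftrightarrow>
      (\<exists>r s U T1 T2 N B1 B2 B3 B4.
        r + s = n \<and> U \<in> carrier_mat n n \<and> real_unitary U \<and>
        T1 \<in> carrier_mat r r \<and> T2 \<in> carrier_mat r s \<and> N \<in> carrier_mat s s \<and>
        B1 \<in> carrier_mat r r \<and> B2 \<in> carrier_mat r s \<and>
        B3 \<in> carrier_mat s r \<and> B4 \<in> carrier_mat s s \<and>
        Ahat = dual_mat (U * four_block_mat T1 T2 (0\<^sub>m s r) N * transpose_mat U)
                        (U * four_block_mat B1 B2 B3 B4 * transpose_mat U) \<and>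
        invertible_mat T1 \<and> N ^\<^sub>m m = 0\<^sub>m s s \<and>
        (let Tt = mat_sum r s (\<lambda>i. T1 ^\<^sub>m i * T2 * N ^\<^sub>m (m - 1 - i)) {0..<m};
             F = (\<lambda>i. mat_sum r s (\<lambda>j. T1 ^\<^sub>m j * T2 * N ^\<^sub>m (i - 2 - j)) {0..<i - 1})
         in mat_sum s s (\<lambda>i. N ^\<^sub>m (m - i) * B3 * mat_powi T1 (int i - int m - 1) * Tt) {1..m} =
            mat_sum s s (\<lambda>i. N ^\<^sub>m (m - i) * B3 * F i + N ^\<^sub>m (m - i) * B4 * N ^\<^sub>m (i - 1)) {1..m})))
    \<and>
     ((\<exists>X. is_dual_core_ep_inverse Ahat X)
      \<longleftrightarrow>
      (1\<^sub>m n - A ^\<^sub>m m * core_ep_inverse (A ^\<^sub>m m)) * S *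
        (1\<^sub>m n - core_ep_inverse (A ^\<^sub>m m) * A ^\<^sub>m m) = 0\<^sub>m n n)"
proof -
  note A = assms(1) and B = assms(2) and Ahat = assms(3) and m = assms(4) and S = assms(5)
  let ?X = "core_ep_inverse (A ^\<^sub>m m)"
  let ?corner = "(1\<^sub>m n - A ^\<^sub>m m * ?X) * S * (1\<^sub>m n - ?X * A ^\<^sub>m m) = 0\<^sub>m n n"
  obtain r s U T1 T2 N where d: "r + s = n" "U \<in> carrier_mat n n"
    "U * transpose_mat U = 1\<^sub>m n" "transpose_mat U * U = 1\<^sub>m n"
    "T1 \<in> carrier_mat r r" "T2 \<in> carrier_mat r s" "N \<in> carrier_mat s s"
    "invertible_mat T1" "N ^\<^sub>m m = 0\<^sub>m s s"
    "A = U * four_block_mat T1 T2 (0\<^sub>m s r) N * transpose_mat U"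
    by (rule core_ep_decomposition_index[OF A, unfolded m])
  define K where "K = transpose_mat U * B * U"
  have K: "K \<in> carrier_mat (r + s) (r + s)" using d(1,2) B by (simp add: K_def)
  obtain B1 B2 B3 B4 where "split_block K r r = (B1, B2, B3, B4)" by (cases "split_block K r r") auto
  note Kb = split_block[OF this, of s s]
  have B14: "B1 \<in> carrier_mat r r" "B2 \<in> carrier_mat r s" "B3 \<in> carrier_mat s r"
    "B4 \<in> carrier_mat s s" "K = four_block_mat B1 B2 B3 B4"
    using Kb K by auto
  have BK: "B = U * four_block_mat B1 B2 B3 B4 * transpose_mat U"
    using orth_conj_inverse(2)[OF d(2-4) B] unfolding K_def[symmetric] B14(5) orth_conj_def by simp
  note main = corner_zero_iff_block_equation[OF d(1-7) B14(1-4) d(10) BK d(8,9), folded S]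
  have i_iii: "(\<exists>Y. is_dual_core_ep_inverse Ahat Y) \<longleftrightarrow> ?corner"
    unfolding Ahat S by (rule dual_core_ep_inverse_exists_iff_corner[OF A B m main(1)])
  \<comment> \<open>The exponents of \<open>N\<close> in \<open>F i\<close> and in the off-diagonal block of the power \<open>i - 1\<close>.\<close>
  have sub: "i - 2 - j = i - 1 - 1 - j" for i j :: nat by simp
  show ?thesis (is "(?i \<longleftrightarrow> ?ii) \<and> (?i \<longleftrightarrow> _)")
  proof (intro conjI)
    show "?i \<longleftrightarrow> ?corner" by (rule i_iii)
    show "?i \<longleftrightarrow> ?ii"
      unfolding i_iii
    proof
      assume c: ?corner
      have U: "real_unitary U"
        using d(2-4) by (auto simp: real_unitary_def inverts_mat_def)
      show ?ii
        apply (rule exI[of _ r], rule exI[of _ s], rule exI[of _ U], rule exI[of _ T1], rule exI[of _ T2],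
            rule exI[of _ N], rule exI[of _ B1], rule exI[of _ B2], rule exI[of _ B3], rule exI[of _ B4])
        apply (intro conjI d B14 U)
        subgoal unfolding Ahat d(10)[symmetric] BK[symmetric] ..
        subgoal using main(2) c unfolding upper_pow_corner_def Let_def sub by blast
        done
    next
      assume ?ii
      then show ?corner
      proof (elim exE conjE)
        fix r s :: nat and U T1 T2 N B1 B2 B3 B4 :: "real mat"
        assume d: "r + s = n" "U \<in> carrier_mat n n" "T1 \<in> carrier_mat r r" "T2 \<in> carrier_mat r s"
          "N \<in> carrier_mat s s" "B1 \<in> carrier_mat r r" "B2 \<in> carrier_mat r s"
          "B3 \<in> carrier_mat s r" "B4 \<in> carrier_mat s s" "invertible_mat T1" "N ^\<^sub>m m = 0\<^sub>m s s"
        assume U: "real_unitary U"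
        assume eq: "Ahat = dual_mat (U * four_block_mat T1 T2 (0\<^sub>m s r) N * transpose_mat U)
                        (U * four_block_mat B1 B2 B3 B4 * transpose_mat U)"
        assume blk: "let Tt = mat_sum r s (\<lambda>i. T1 ^\<^sub>m i * T2 * N ^\<^sub>m (m - 1 - i)) {0..<m};
             F = (\<lambda>i. mat_sum r s (\<lambda>j. T1 ^\<^sub>m j * T2 * N ^\<^sub>m (i - 2 - j)) {0..<i - 1})
         in mat_sum s s (\<lambda>i. N ^\<^sub>m (m - i) * B3 * mat_powi T1 (int i - int m - 1) * Tt) {1..m} =
            mat_sum s s (\<lambda>i. N ^\<^sub>m (m - i) * B3 * F i + N ^\<^sub>m (m - i) * B4 * N ^\<^sub>m (i - 1)) {1..m}"
        have Uo: "U * transpose_mat U = 1\<^sub>m n" "transpose_mat U * U = 1\<^sub>m n"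
          using U d(2) by (auto simp: real_unitary_def inverts_mat_def)
        have c: "four_block_mat T1 T2 (0\<^sub>m s r) N \<in> carrier_mat n n"
          "four_block_mat B1 B2 B3 B4 \<in> carrier_mat n n" using d by auto
        have AB: "A = U * four_block_mat T1 T2 (0\<^sub>m s r) N * transpose_mat U"
          "B = U * four_block_mat B1 B2 B3 B4 * transpose_mat U"
          using eq orth_conj_carrier[OF d(2) Uo c(1)] orth_conj_carrier[OF d(2) Uo c(2)]
            dual_mat_eq_iff[OF A B] unfolding Ahat orth_conj_def by blast+
        show ?corner
          using corner_zero_iff_block_equation(2)[OF d(1,2) Uo d(3-9) AB d(10,11), folded S] blk
          unfolding upper_pow_corner_def Let_def sub by blast
      qed
    qed
  qed
qed

end
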